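(* Let $C\subset\mathbb{P}^2$ be the projective closure, over $\mathbb{Q}$, of the affine plane cubic $x^2y+3x^2-xy-3y^2-3x-3y=0$. Then $C$ is nonsingular, and it is birational over $\mathbb{Q}$ to the elliptic curve $$E_0:\ V^2=U^3-384048\,U+82988928,$$ (the curve with Cremona label 30a2) via $$U=\frac{1176x-468y-468}{2x-3y-3},\qquad V=\frac{15552(x+y-1)}{2x-3y-3}.$$ The curve $C$ has exactly twelve rational points, namely, the affine points $(x,y)$ $$(1,0),\ (3,3),\ (\tfrac12,-\tfrac13),\ (0,0),\ (-2,3),\ (3,-2),\ (1,-1),\ (\tfrac12,-\tfrac34),\ (-2,-2),\ (0,-1)$$ and the points at infinity $(0:1:0)$ and $(1:0:0)$ in coordinates $(x:y:z)$. Among these, only $(\tfrac12,-\tfrac13)$ lies on the arc $0<x<1$, $-\tfrac13\le y<0$ of stable tensegrity parameters, and for this parameter the nodes and cables of the tensegrity form the vertices and edges of a cuboctahedron.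
   Context: Permutations are composed right to left. In the alternating group $A_4$ put $s=g_1=(1,2,3)$, $g_2=(1,2)(3,4)$, $g_3=(1,3)(2,4)$, $c_1=(1,3,4)=g_1g_2$, $c_2=(2,4,3)=g_1g_3$. Let $\rho\colon A_4\to \mathrm{GL}(3,\mathbb{Z})$ be the representation with $$\rho(g_1)=\begin{pmatrix}0&1&0\\0&0&-1\\-1&0&0\end{pmatrix},\quad \rho(g_2)=\mathrm{diag}(1,-1,-1),\quad \rho(g_3)=\mathrm{diag}(-1,1,-1).$$ For real $x,y$ the stress matrix is $$\Omega(x,y)=x\bigl(\rho(c_1)+\rho(c_1^{-1})\bigr)+(1-x)\bigl(\rho(c_2)+\rho(c_2^{-1})\bigr)+y\bigl(\rho(s)+\rho(s^{-1})\bigr)-2(1+y)I_3 ,$$ and $\det\Omega(x,y)=8(x^2y+3x^2-xy-3y^2-3x-3y)$. When this determinant vanishes, the vector $$\mathbf{p}_0=\begin{pmatrix}-2xy+3y^2-6x+2y+3\\-4x^2-4xy+3y^2+4x+10y+3\\4x^2-3y^2-4x+3\end{pmatrix}$$ satisfies $\Omega(x,y)\mathbf{p}_0=\mathbf{0}$. The tensegrity with parameter $(x,y)$ has nodes $\rho(g)\mathbf{p}_0$, $g\in A_4$; nodes $\rho(g)\mathbf{p}_0$ and $\rho(h)\mathbf{p}_0$ are joined by a strut (straight segment) if $h=gs$, and by a cable (straight segment) if $h=gc_1$ or $h=gc_2$. The stable parameters are the points of $\det\Omega(x,y)=0$ with $0<x<1$ and $-\frac13\le y<0$. *)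

theory Defs
  imports
    "HOL-Algebra.Sym_Groups"
    "HOL-Algebra.Algebraic_Closure_Type"
    "HOL-Analysis.Analysis"
begin

section \<open>Plane curves over the rationals\<close>

text \<open>
  A bivariate polynomial in \<open>x, y\<close> is a polynomial in \<open>y\<close> whose coefficients are
  polynomials in \<open>x\<close>; a trivariate polynomial in \<open>x, y, z\<close> is a polynomial in \<open>z\<close> whose
  coefficients are bivariate polynomials. Coefficients are rational, and points may have
  coordinates in any field of characteristic 0 (in particular in \<open>rat\<close> itself and in its
  algebraic closure \<open>rat alg_closure\<close>).
\<close>

definition var_x :: "rat poly poly" where "var_x = [:[:0, 1:]:]"
definition var_y :: "rat poly poly" where "var_y = [:0, 1:]"

definition eval1 :: "rat poly \<Rightarrow> 'a::field_char_0 \<Rightarrow> 'a" where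
  "eval1 p x = poly (map_poly of_rat p) x"

definition eval2 :: "rat poly poly \<Rightarrow> 'a::field_char_0 \<Rightarrow> 'a \<Rightarrow> 'a" where
  "eval2 p x y = poly (map_poly (\<lambda>q. eval1 q x) p) y"

definition eval3 :: "rat poly poly poly \<Rightarrow> 'a::field_char_0 \<Rightarrow> 'a \<Rightarrow> 'a \<Rightarrow> 'a" where
  "eval3 p x y z = poly (map_poly (\<lambda>q. eval2 q x y) p) z"

definition deriv_x :: "rat poly poly poly \<Rightarrow> rat poly poly poly" where
  "deriv_x = map_poly (map_poly pderiv)"
definition deriv_y :: "rat poly poly poly \<Rightarrow> rat poly poly poly" where
  "deriv_y = map_poly pderiv"
definition deriv_z :: "rat poly poly poly \<Rightarrow> rat poly poly poly" where
  "deriv_z = pderiv"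

definition total_degree :: "rat poly poly \<Rightarrow> nat" where
  "total_degree f = Max {i + j | i j. poly.coeff (poly.coeff f j) i \<noteq> 0}"

definition homogenize :: "rat poly poly \<Rightarrow> rat poly poly poly" where
  "homogenize f =
    (\<Sum>j\<le>Polynomial.degree f. \<Sum>i\<le>Polynomial.degree (poly.coeff f j).
       Polynomial.monom (Polynomial.monom (Polynomial.monom (poly.coeff (poly.coeff f j) i) i) j)
         (total_degree f - i - j))"

text \<open>The point \<open>(x : y : z)\<close> of the projective plane, as the set of its coordinate triples.\<close>

definition proj_pt :: "'a::field \<Rightarrow> 'a \<Rightarrow> 'a \<Rightarrow> ('a \<times> 'a \<times> 'a) set" where
  "proj_pt x y z = {(c * x, c * y, c * z) | c. c \<noteq> 0}"

text \<open>
  The points, with coordinates in the field \<open>'a\<close>, of the projective closure of the affine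
  curve \<open>f = 0\<close>.
\<close>

definition proj_closure :: "rat poly poly \<Rightarrow> ('a::field_char_0 \<times> 'a \<times> 'a) set set" where
  "proj_closure f =
    {proj_pt x y z | x y z. (x, y, z) \<noteq> (0, 0, 0) \<and> eval3 (homogenize f) x y z = 0}"

text \<open>
  Nonsingularity is required at all geometric points of the projective closure, not only at
  the rational ones.
\<close>

definition nonsingular :: "rat poly poly \<Rightarrow> bool" where
  "nonsingular f \<longleftrightarrow>
    (\<forall>x y z :: rat alg_closure.
       (x, y, z) \<noteq> (0, 0, 0) \<and> eval3 (homogenize f) x y z = 0 \<longrightarrow>
       eval3 (deriv_x (homogenize f)) x y z \<noteq> 0 \<or>
       eval3 (deriv_y (homogenize f)) x y z \<noteq> 0 \<or>
       eval3 (deriv_z (homogenize f)) x y z \<noteq> 0)"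


section \<open>Birational maps over the rationals\<close>

text \<open>
  A rational map between plane curves is given by two quotients of bivariate polynomials
  (numerator, denominator) in the affine coordinates.
\<close>

type_synonym rat_fun = "rat poly poly \<times> rat poly poly"
type_synonym rat_map = "rat_fun \<times> rat_fun"

definition regular_at :: "rat_map \<Rightarrow> 'a::field_char_0 \<times> 'a \<Rightarrow> bool" where
  "regular_at = (\<lambda>((n1, d1), (n2, d2)) (x, y). eval2 d1 x y \<noteq> 0 \<and> eval2 d2 x y \<noteq> 0)"

definition apply_map :: "rat_map \<Rightarrow> 'a::field_char_0 \<times> 'a \<Rightarrow> 'a \<times> 'a" where
  "apply_map = (\<lambda>((n1, d1), (n2, d2)) (x, y).
     (eval2 n1 x y / eval2 d1 x y, eval2 n2 x y / eval2 d2 x y))"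

definition aff_pt :: "'a::field \<times> 'a \<Rightarrow> ('a \<times> 'a \<times> 'a) set" where
  "aff_pt = (\<lambda>(x, y). proj_pt x y 1)"

text \<open>
  On a curve over an algebraically closed field, a dense open subset is the complement of a
  finite set of points. Rational maps have to be defined on such a subset, and two rational
  maps are equal if they are defined and agree on such a subset.
\<close>

definition rational_map_between :: "rat_map \<Rightarrow> rat poly poly \<Rightarrow> rat poly poly \<Rightarrow> bool" where
  "rational_map_between \<phi> f g \<longleftrightarrow>
    finite {P \<in> proj_closure f. \<not> (\<exists>a :: rat alg_closure \<times> rat alg_closure.
              P = aff_pt a \<and> regular_at \<phi> a)} \<and>
    (\<forall>a :: rat alg_closure \<times> rat alg_closure.
       aff_pt a \<in> proj_closure f \<and> regular_at \<phi> a \<longrightarrow> aff_pt (apply_map \<phi> a) \<in> proj_closure g)"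

definition comp_is_identity :: "rat_map \<Rightarrow> rat_map \<Rightarrow> rat poly poly \<Rightarrow> bool" where
  "comp_is_identity \<psi> \<phi> f \<longleftrightarrow>
    finite {P \<in> proj_closure f. \<not> (\<exists>a :: rat alg_closure \<times> rat alg_closure.
              P = aff_pt a \<and> regular_at \<phi> a \<and> regular_at \<psi> (apply_map \<phi> a) \<and>
              apply_map \<psi> (apply_map \<phi> a) = a)}"

definition birational_via :: "rat_map \<Rightarrow> rat poly poly \<Rightarrow> rat poly poly \<Rightarrow> bool" where
  "birational_via \<phi> f g \<longleftrightarrow>
    rational_map_between \<phi> f g \<and>
    (\<exists>\<psi>. rational_map_between \<psi> g f \<and> comp_is_identity \<psi> \<phi> f \<and> comp_is_identity \<phi> \<psi> g)"


section \<open>The curves\<close>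

definition cubic_C :: "rat poly poly" where
  "cubic_C = var_x\<^sup>2 * var_y + 3 * var_x\<^sup>2 - var_x * var_y - 3 * var_y\<^sup>2 - 3 * var_x - 3 * var_y"

definition weierstrass :: "rat \<Rightarrow> rat \<Rightarrow> rat \<Rightarrow> rat \<Rightarrow> rat \<Rightarrow> rat poly poly" where
  "weierstrass a1 a2 a3 a4 a6 =
    var_y\<^sup>2 + [:[:a1:]:] * var_x * var_y + [:[:a3:]:] * var_y
    - (var_x ^ 3 + [:[:a2:]:] * var_x\<^sup>2 + [:[:a4:]:] * var_x + [:[:a6:]:])"

text \<open>Isomorphism over the rationals of curves in Weierstrass form: admissible changes of variables.\<close>

definition weierstrass_iso :: "rat poly poly \<Rightarrow> rat poly poly \<Rightarrow> bool" where
  "weierstrass_iso e e' \<longleftrightarrow>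
    (\<exists>u r s t :: rat. u \<noteq> 0 \<and>
       (\<forall>x y :: rat. eval2 e (u\<^sup>2 * x + r) (u ^ 3 * y + u\<^sup>2 * s * x + t) = u ^ 6 * eval2 e' x y))"

definition curve_E0 :: "rat poly poly" where
  "curve_E0 = weierstrass 0 0 0 (-384048) 82988928"

text \<open>
  The global minimal model \<open>y\<^sup>2 + x y + y = x\<^sup>3 - 19 x + 26\<close> listed under the label 30a2 in
  Cremona's tables.
\<close>

definition cremona_30a2 :: "rat poly poly" where
  "cremona_30a2 = weierstrass 1 0 1 (-19) 26"

definition map_UV :: rat_map where
  "map_UV =
    ((1176 * var_x - 468 * var_y - 468, 2 * var_x - 3 * var_y - 3),
     (15552 * (var_x + var_y - 1), 2 * var_x - 3 * var_y - 3))"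


section \<open>The tensegrities\<close>

definition g1 :: "nat \<Rightarrow> nat" where "g1 = cycle_of_list [1, 2, 3]"
definition g2 :: "nat \<Rightarrow> nat" where "g2 = cycle_of_list [1, 2] \<circ> cycle_of_list [3, 4]"
definition g3 :: "nat \<Rightarrow> nat" where "g3 = cycle_of_list [1, 3] \<circ> cycle_of_list [2, 4]"
definition c1 :: "nat \<Rightarrow> nat" where "c1 = cycle_of_list [1, 3, 4]"
definition c2 :: "nat \<Rightarrow> nat" where "c2 = cycle_of_list [2, 4, 3]"

definition GL :: "('a::semiring_1 ^ 'n ^ 'n) monoid" where
  "GL = \<lparr>carrier = {M. invertible M}, monoid.mult = (**), one = mat 1\<rparr>"

text \<open>
  The representation is determined by its values on \<open>g1\<close>, \<open>g2\<close>, \<open>g3\<close>, which generate the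
  alternating group. It exists: with the tetrahedron vertices \<open>v1 = (-1,-1,-1)\<close>,
  \<open>v2 = (-1,1,1)\<close>, \<open>v3 = (1,-1,1)\<close>, \<open>v4 = (1,1,-1)\<close>, it sends \<open>p\<close> to the linear map that
  takes each \<open>v i\<close> to \<open>v (p i)\<close>.
\<close>

definition is_rho :: "((nat \<Rightarrow> nat) \<Rightarrow> int ^ 3 ^ 3) \<Rightarrow> bool" where
  "is_rho \<rho> \<longleftrightarrow>
    \<rho> \<in> hom (alt_group 4) GL \<and>
    \<rho> g1 = vector [vector [0, 1, 0], vector [0, 0, -1], vector [-1, 0, 0]] \<and>
    \<rho> g2 = vector [vector [1, 0, 0], vector [0, -1, 0], vector [0, 0, -1]] \<and>
    \<rho> g3 = vector [vector [-1, 0, 0], vector [0, 1, 0], vector [0, 0, -1]]"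

definition real_mat :: "int ^ 'n ^ 'm \<Rightarrow> real ^ 'n ^ 'm" where
  "real_mat M = (\<chi> i j. of_int (M $ i $ j))"

definition stress :: "((nat \<Rightarrow> nat) \<Rightarrow> int ^ 3 ^ 3) \<Rightarrow> real \<Rightarrow> real \<Rightarrow> real ^ 3 ^ 3" where
  "stress \<rho> x y =
    (let sym = (\<lambda>g. real_mat (\<rho> g + \<rho> (inv\<^bsub>alt_group 4\<^esub> g)))
     in x *\<^sub>R sym c1 + (1 - x) *\<^sub>R sym c2 + y *\<^sub>R sym g1 - (2 * (1 + y)) *\<^sub>R mat 1)"

definition stable_params :: "((nat \<Rightarrow> nat) \<Rightarrow> int ^ 3 ^ 3) \<Rightarrow> (real \<times> real) set" where
  "stable_params \<rho> = {(x, y). det (stress \<rho> x y) = 0 \<and> 0 < x \<and> x < 1 \<and> -1/3 \<le> y \<and> y < 0}"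

definition p0 :: "real \<Rightarrow> real \<Rightarrow> real ^ 3" where
  "p0 x y = vector
    [-2*x*y + 3*y\<^sup>2 - 6*x + 2*y + 3,
     -4*x\<^sup>2 - 4*x*y + 3*y\<^sup>2 + 4*x + 10*y + 3,
     4*x\<^sup>2 - 3*y\<^sup>2 - 4*x + 3]"

definition node :: "((nat \<Rightarrow> nat) \<Rightarrow> int ^ 3 ^ 3) \<Rightarrow> real \<Rightarrow> real \<Rightarrow> (nat \<Rightarrow> nat) \<Rightarrow> real ^ 3" where
  "node \<rho> x y g = real_mat (\<rho> g) *v p0 x y"

definition nodes :: "((nat \<Rightarrow> nat) \<Rightarrow> int ^ 3 ^ 3) \<Rightarrow> real \<Rightarrow> real \<Rightarrow> (real ^ 3) set" where
  "nodes \<rho> x y = node \<rho> x y ` carrier (alt_group 4)"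

definition cables :: "((nat \<Rightarrow> nat) \<Rightarrow> int ^ 3 ^ 3) \<Rightarrow> real \<Rightarrow> real \<Rightarrow> (real ^ 3) set set" where
  "cables \<rho> x y =
    {closed_segment (node \<rho> x y g) (node \<rho> x y h) | g h.
       g \<in> carrier (alt_group 4) \<and> h \<in> carrier (alt_group 4) \<and>
       (h = g \<otimes>\<^bsub>alt_group 4\<^esub> c1 \<or> h = g \<otimes>\<^bsub>alt_group 4\<^esub> c2)}"

text \<open>
  The model cuboctahedron has as vertices all permutations of \<open>(0, \<plusminus>1, \<plusminus>1)\<close>, that is, the
  midpoints of the edges of the cube with vertices \<open>(\<plusminus>1, \<plusminus>1, \<plusminus>1)\<close>. A cuboctahedron is any
  solid similar to it.
\<close>

definition std_cuboctahedron :: "(real ^ 3) set" where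
  "std_cuboctahedron = convex hull {v. \<exists>i. v $ i = 0 \<and> (\<forall>j. j \<noteq> i \<longrightarrow> \<bar>v $ j\<bar> = 1)}"

definition is_cuboctahedron :: "(real ^ 3) set \<Rightarrow> bool" where
  "is_cuboctahedron P \<longleftrightarrow>
    (\<exists>r a f. r > 0 \<and> orthogonal_transformation f \<and>
       P = (\<lambda>v. a + r *\<^sub>R f v) ` std_cuboctahedron)"

end

theory Submission
  imports Defs
begin

text \<open>
  On the cubic \<open>C\<close> the line \<open>d = 0\<close> with \<open>d = 2 * x - 3 * y - 3\<close> is the tangent at the flex \<open>(0, -1)\<close>.
  Sending that flex to infinity by \<open>p = 8 * (x + 3 * y + 3) / d\<close>, \<open>q = 72 * (x + y - 1) / d\<close> turns \<open>C\<close>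
  into \<open>p * (p + 5) * (p + 32) = q\<^sup>2\<close>, and \<open>u = 36 * p + 444\<close>, \<open>v = 216 * q\<close> leads to the curve \<open>E\<^sub>0\<close>. The
  identity \<open>(5 * p + 16 - q) * d = 144\<close> makes the inverse map visible. Everything that is claimed
  about the map, the nonsingularity and the minimal model is then a polynomial identity
  (\<open>birational_map_UV\<close>, \<open>nonsingular_cubic_C\<close>, \<open>weierstrass_iso_E0\<close>).

  The arithmetic content is \<open>split_cubic_points\<close>: the split cubic has no rational points with \<open>q \<noteq> 0\<close>
  besides \<open>p = 4, 40, -8, -20\<close>. This is a 2-descent without group law. The three factors \<open>p\<close>, \<open>p + 5\<close>,
  \<open>p + 32\<close> are squares up to divisors of 10, 15, 6. Translation by the 2-torsion points, which acts on
  \<open>p\<close> by the fractional linear maps \<open>p \<mapsto> 160 / p\<close> and \<open>p \<mapsto> -5 * (p + 32) / (p + 5)\<close>, and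
  three conics without points over the 3-adic or 5-adic numbers leave the case that all three factors
  are squares. In lowest terms this is the concordant system
  \<open>p\<^sup>2 + 5 * q\<^sup>2 = r\<^sup>2\<close>, \<open>p\<^sup>2 + 32 * q\<^sup>2 = s\<^sup>2\<close>, which has the solution \<open>(p, q) = (2, 1)\<close>, a point of
  order 3. Since that point is its own half up to sign, descent cannot end in a contradiction; instead
  every solution is the double of another solution (\<open>concordant_halving\<close>), the duplication formula with
  an exact bound for the cancellation (\<open>concordant_gcd\<close>) shows that the other one has a smaller
  denominator unless it is \<open>(2, 1)\<close>, and so \<open>(2, 1)\<close> is the only one (\<open>concordant_unique\<close>).

  For the tensegrity, the representation permutes the twelve integer vectors that are the vertices of
  the standard cuboctahedron, and \<open>p0 (1/2) (-1/3)\<close> is \<open>5/3\<close> times one of them. Two vertices span an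
  edge iff their inner product is 1: then their sum is the normal of a supporting plane that touches in
  these two vertices only, and otherwise their midpoint is also the midpoint of another
  segment in the solid (\<open>solid_edges\<close>). The cables are the pairs with inner product 1.
\<close>

section \<open>Square classes and local obstructions\<close>

text \<open>
  If \<open>a * b\<close> is a rational square, primes of odd multiplicity in \<open>a\<close> have odd multiplicity in \<open>b\<close> too, so
  the squarefree part of \<open>a\<close> is built from common primes. The factor \<open>e\<close> allows \<open>a\<close> and \<open>b\<close> to be
  stripped of a common constant beforehand.
\<close>

lemma square_class:
  fixes a b c e N :: int
  assumes eq: "a * b * e\<^sup>2 = c\<^sup>2" and nz: "a \<noteq> 0" "b \<noteq> 0" "e \<noteq> 0"
    and common: "\<And>l. Factorial_Ring.prime l \<Longrightarrow> l dvd a \<Longrightarrow> l dvd b \<Longrightarrow> l dvd N"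
  obtains d m where "d dvd N" "a = d * m\<^sup>2"
proof (cases "N = 0")
  case True
  then show ?thesis using that[of a 1] by simp
next
  case False
  let ?d = "squarefree_part a"
  have c: "c \<noteq> 0" using eq nz by auto
  have "?d dvd N"
  proof (rule multiplicity_le_imp_dvd)
    fix l :: int assume l: "Factorial_Ring.prime l"
    have pe: "prime_elem l" using l by (rule prime_imp_prime_elem)
    have m: "multiplicity l ?d = multiplicity l a mod 2"
      using nz l by (simp add: prime_multiplicity_squarefree_part)
    show "multiplicity l ?d \<le> multiplicity l N"
    proof (cases "odd (multiplicity l a)")
      case False
      then show ?thesis using m by simp
    next
      case True
      have "multiplicity l a + multiplicity l b + 2 * multiplicity l e = 2 * multiplicity l c"
        using arg_cong[OF eq, of "multiplicity l"] nz c pe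
        by (simp add: prime_elem_multiplicity_mult_distrib prime_elem_multiplicity_power_distrib)
      then have "odd (multiplicity l b)" using True by presburger
      then have "l dvd a" "l dvd b" using True
        by (metis even_zero not_dvd_imp_multiplicity_0)+
      then have "l dvd N" using common l by blast
      then have "multiplicity l N \<ge> 1"
        using \<open>N \<noteq> 0\<close> pe by (metis One_nat_def Suc_leI prime_elem_multiplicity_eq_zero_iff not_gr_zero)
      then show ?thesis using m by simp
    qed
  qed (use \<open>N \<noteq> 0\<close> in auto)
  then show ?thesis using that squarefree_decompose[of a] by blast
qed

lemma three_dvd_sum_squares:
  fixes x y :: int assumes "3 dvd x\<^sup>2 + y\<^sup>2" shows "3 dvd x \<and> 3 dvd y"
proof -
  define u v where uv: "u = x mod 3" "v = y mod 3"
  have "(u\<^sup>2 + v\<^sup>2) mod 3 = (x\<^sup>2 + y\<^sup>2) mod 3"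
    unfolding uv by (intro mod_add_cong) (simp_all add: power_mod)
  then have "(u\<^sup>2 + v\<^sup>2) mod 3 = 0" using assms by simp
  moreover have "u = 0 \<or> u = 1 \<or> u = 2" "v = 0 \<or> v = 1 \<or> v = 2" unfolding uv by presburger+
  ultimately have "u = 0 \<and> v = 0" by (elim disjE) simp_all
  then show ?thesis unfolding uv by (simp add: mod_0_imp_dvd)
qed

lemma five_dvd_nonresidue_form:
  fixes x y :: int assumes "5 dvd x\<^sup>2 - c * y\<^sup>2" and "c = 2 \<or> c = 3" shows "5 dvd x \<and> 5 dvd y"
proof -
  define u v where uv: "u = x mod 5" "v = y mod 5"
  have "(u\<^sup>2 - c * v\<^sup>2) mod 5 = (x\<^sup>2 - c * y\<^sup>2) mod 5"
    unfolding uv by (intro mod_diff_cong mod_mult_cong refl) (simp_all add: power_mod)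
  then have "(u\<^sup>2 - c * v\<^sup>2) mod 5 = 0" using assms(1) by simp
  moreover have "u = 0 \<or> u = 1 \<or> u = 2 \<or> u = 3 \<or> u = 4" "v = 0 \<or> v = 1 \<or> v = 2 \<or> v = 3 \<or> v = 4"
    unfolding uv by presburger+
  ultimately have "u = 0 \<and> v = 0" using assms(2) by (elim disjE) simp_all
  then show ?thesis unfolding uv by (simp add: mod_0_imp_dvd)
qed

text \<open>
  The form is homogeneous, so a solution that is always divisible by \<open>l\<close> can be divided by \<open>l\<close> forever.
\<close>

lemma ternary_descent_int:
  fixes A B C l x y z :: int
  assumes l: "l > 1"
    and div: "\<And>x y z. A * x\<^sup>2 + B * y\<^sup>2 + C * z\<^sup>2 = 0 \<Longrightarrow> l dvd x \<and> l dvd y \<and> l dvd z"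
    and eq: "A * x\<^sup>2 + B * y\<^sup>2 + C * z\<^sup>2 = 0"
  shows "x = 0 \<and> y = 0 \<and> z = 0"
  using eq
proof (induction "nat (\<bar>x\<bar> + \<bar>y\<bar> + \<bar>z\<bar>)" arbitrary: x y z rule: less_induct)
  case less
  from div[OF less.prems] obtain x' y' z' where e: "x = l * x'" "y = l * y'" "z = l * z'"
    by (auto simp: dvd_def)
  have "l\<^sup>2 * (A * x'\<^sup>2 + B * y'\<^sup>2 + C * z'\<^sup>2) = 0"
    using less.prems unfolding e by (simp add: algebra_simps power2_eq_square)
  then have eq': "A * x'\<^sup>2 + B * y'\<^sup>2 + C * z'\<^sup>2 = 0" using l by simp
  have sm: "\<bar>l * w\<bar> \<ge> 2 * \<bar>w\<bar>" for w
    using l by (simp add: abs_mult mult_right_mono)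
  show ?case
  proof (cases "x' = 0 \<and> y' = 0 \<and> z' = 0")
    case True then show ?thesis using e by simp
  next
    case False
    have "nat (\<bar>x'\<bar> + \<bar>y'\<bar> + \<bar>z'\<bar>) < nat (\<bar>x\<bar> + \<bar>y\<bar> + \<bar>z\<bar>)"
      proof -
      have "0 < \<bar>x'\<bar> + \<bar>y'\<bar> + \<bar>z'\<bar>"
        using False by (auto intro: add_pos_nonneg add_nonneg_pos)
      then have "\<bar>x'\<bar> + \<bar>y'\<bar> + \<bar>z'\<bar> < 2 * \<bar>x'\<bar> + 2 * \<bar>y'\<bar> + 2 * \<bar>z'\<bar>" by simp
      also have "\<dots> \<le> \<bar>x\<bar> + \<bar>y\<bar> + \<bar>z\<bar>" unfolding e by (intro add_mono sm)
      finally show ?thesis by simp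
    qed
    from less.hyps[OF this eq'] show ?thesis using e by simp
  qed
qed

lemma common_denominator3:
  fixes x y z :: rat
  obtains a b c n :: int where "n > 0" "x = of_int a / of_int n" "y = of_int b / of_int n" "z = of_int c / of_int n"
proof -
  obtain a k where 1: "x = of_int a / of_int k" "k > 0" by (metis quotient_of_div quotient_of_denom_pos surj_pair)
  obtain b l where 2: "y = of_int b / of_int l" "l > 0" by (metis quotient_of_div quotient_of_denom_pos surj_pair)
  obtain c m where 3: "z = of_int c / of_int m" "m > 0" by (metis quotient_of_div quotient_of_denom_pos surj_pair)
  show ?thesis
    by (rule that[of "k*l*m" "a*l*m" "b*k*m" "c*k*l"]) (use 1 2 3 in auto)
qed

lemma ternary_descent:
  fixes A B C l :: int and x y z :: rat
  assumes l: "l > 1"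
    and div: "\<And>x y z. A * x\<^sup>2 + B * y\<^sup>2 + C * z\<^sup>2 = 0 \<Longrightarrow> l dvd x \<and> l dvd y \<and> l dvd z"
    and eq: "of_int A * x\<^sup>2 + of_int B * y\<^sup>2 + of_int C * z\<^sup>2 = 0"
  shows "z = 0"
proof -
  obtain a b c n :: int where n: "n > 0" "x = of_int a / of_int n" "y = of_int b / of_int n" "z = of_int c / of_int n"
    by (rule common_denominator3)
  have "(of_int (A * a\<^sup>2 + B * b\<^sup>2 + C * c\<^sup>2) :: rat) = 0"
    using eq n(1) unfolding n(2-4) by (simp add: field_simps power2_eq_square flip: distrib_left)
  then have "A * a\<^sup>2 + B * b\<^sup>2 + C * c\<^sup>2 = 0" by linarith
  then have "a = 0 \<and> b = 0 \<and> c = 0"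
    by (intro ternary_descent_int[of l A B C a b c, OF l div])
  then show ?thesis using n by simp
qed

lemma prime3: "Factorial_Ring.prime (3::int)" by (simp add: prime_int_numeral_eq)

lemma prime5: "Factorial_Ring.prime (5::int)" by (simp add: prime_int_numeral_eq)

text \<open>
  Modulo 3 the left-hand side is a nonzero multiple of \<open>x\<^sup>2 + y\<^sup>2\<close>, which is anisotropic since \<open>-1\<close> is not a
  square modulo 3.
\<close>

lemma no_ternary_zero_mod_3:
  fixes A B :: int and x y z :: rat
  assumes A: "\<not> 3 dvd A" and AB: "3 dvd B - A" and eq: "of_int A * x\<^sup>2 + of_int B * y\<^sup>2 = 3 * z\<^sup>2"
  shows "z = 0"
proof (rule ternary_descent[of 3 A B "-3" x y])
  fix x y z :: int assume h: "A * x\<^sup>2 + B * y\<^sup>2 + (-3) * z\<^sup>2 = 0"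
  obtain k where k: "B = A + 3 * k" using AB by (metis dvdE diff_eq_eq add.commute)
  have "A * (x\<^sup>2 + y\<^sup>2) = 3 * (z\<^sup>2 - k * y\<^sup>2)" using h unfolding k by (simp add: algebra_simps)
  then have "3 dvd A * (x\<^sup>2 + y\<^sup>2)" by (rule dvdI)
  then have "3 dvd x\<^sup>2 + y\<^sup>2" using A prime_dvd_multD[OF prime3] by blast
  then have *: "3 dvd x \<and> 3 dvd y" by (rule three_dvd_sum_squares)
  then obtain u v where "x = 3 * u" "y = 3 * v" by (auto simp: dvd_def)
  then have "z\<^sup>2 = 3 * (A * u\<^sup>2 + B * v\<^sup>2)" using h by (simp add: power2_eq_square)
  then have "3 dvd z\<^sup>2" by (rule dvdI)
  then have "3 dvd z" by (rule prime_dvd_power[OF prime3])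
  with * show "3 dvd x \<and> 3 dvd y \<and> 3 dvd z" by simp
qed (use eq in auto)

text \<open>
  The form \<open>x\<^sup>2 - c * y\<^sup>2\<close> is anisotropic modulo 5, since 2 and 3 are the nonresidues.
\<close>

lemma no_ternary_zero_mod_5: fixes x y z :: rat and c :: int
  assumes "c = 2 \<or> c = 3" and "\<bar>k\<bar> = (1::int)" and "x\<^sup>2 - of_int c * y\<^sup>2 = 5 * of_int k * z\<^sup>2" shows "z = 0"
proof (rule ternary_descent[of 5 1 "-c" "-5 * k" x y])
  fix x y z :: int assume h: "1 * x\<^sup>2 + (-c) * y\<^sup>2 + (-5 * k) * z\<^sup>2 = 0"
  then have "x\<^sup>2 - c * y\<^sup>2 = 5 * (k * z\<^sup>2)" by simp
  then have *: "5 dvd x \<and> 5 dvd y" by (rule five_dvd_nonresidue_form[OF dvdI assms(1)])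
  then obtain u v where "x = 5 * u" "y = 5 * v" by (auto simp: dvd_def)
  then have "k * z\<^sup>2 = 5 * (u\<^sup>2 - c * v\<^sup>2)" using h by (simp add: power2_eq_square algebra_simps)
  moreover have "k = 1 \<or> k = -1" using assms(2) by linarith
    ultimately have "z\<^sup>2 = 5 * (k * (u\<^sup>2 - c * v\<^sup>2))" by (elim disjE) simp_all
    then have "5 dvd z\<^sup>2" by (rule dvdI)
  then have "5 dvd z" by (rule prime_dvd_power[OF prime5])
  with * show "5 dvd x \<and> 5 dvd y \<and> 5 dvd z" by simp
qed (use assms in auto)

section \<open>Halving solutions of the concordant system\<close>

lemma concordant_parity:
  fixes p q r s :: int
  assumes "coprime p q" and r: "p\<^sup>2 + 5 * q\<^sup>2 = r\<^sup>2" and s: "p\<^sup>2 + 32 * q\<^sup>2 = s\<^sup>2"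
  shows "odd p \<and> even q \<and> odd r \<and> odd s \<or>
    (\<exists>p1 s1. p = 2 * p1 \<and> s = 2 * s1 \<and> odd p1 \<and> odd s1 \<and> odd q \<and> odd r)"
proof (cases "odd p")
  case True
  have "even q"
  proof (rule ccontr)
    assume "odd q"
    have "even r" using arg_cong[OF r, of even] True \<open>odd q\<close> by simp
    then obtain a b c where "p = 2*a+1" "q = 2*b+1" "r = 2*c"
      using True \<open>odd q\<close> by (metis oddE evenE)
    then have "4 * (a\<^sup>2 + a) + 20 * (b\<^sup>2 + b) + 6 = 4 * c\<^sup>2"
      using r by (simp add: power2_eq_square algebra_simps)
    then show False by presburger
  qed
  moreover have "odd r" using arg_cong[OF r, of even] True \<open>even q\<close> by simp
  moreover have "odd s" using arg_cong[OF s, of even] True by simp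
  ultimately show ?thesis using True by simp
next
  case False
  then have q: "odd q" using assms(1) by (meson coprime_common_divisor odd_one)
  have or: "odd r" using arg_cong[OF r, of even] False q by simp
  have "even s" using arg_cong[OF s, of even] False by simp
  then obtain p1 s1 where ps: "p = 2 * p1" "s = 2 * s1" using False by (auto elim!: evenE)
  have "odd p1"
  proof
    assume "even p1"
    then obtain a b c where "p = 4*a" "q = 2*b+1" "r = 2*c+1"
      using ps or q by (auto elim!: oddE evenE)
    then have e: "c\<^sup>2 + c = 4 * a\<^sup>2 + 5 * (b\<^sup>2 + b) + 1"
      using r by (simp add: power2_eq_square algebra_simps)
    have "even (c\<^sup>2 + c)" "even (b\<^sup>2 + b)" by simp_all
    then show False using arg_cong[OF e, of even] by simp
  qed
  have e: "s1\<^sup>2 = p1\<^sup>2 + 8 * q\<^sup>2" using s unfolding ps by simp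
  from arg_cong[OF e, of even] \<open>odd p1\<close> have "odd s1" by simp
  with \<open>odd p1\<close> show ?thesis using ps q or by blast
qed

text \<open>
  Used for the factorizations of \<open>r\<^sup>2 - p\<^sup>2\<close>, \<open>s\<^sup>2 - p\<^sup>2\<close>, \<open>s\<^sup>2 - r\<^sup>2\<close> into sum and difference; \<open>\<kappa>\<close> is the power
  of 2 that the sum and the difference share.
\<close>

lemma sum_class:
  fixes x y w k \<kappa> a b N :: int
  assumes eq: "y\<^sup>2 - x\<^sup>2 = k * w\<^sup>2" and ab: "y + x = \<kappa> * a" "y - x = \<kappa> * b"
    and nz: "\<kappa> \<noteq> 0" "k \<noteq> 0" "w \<noteq> 0" "a > 0"
    and common: "\<And>l. Factorial_Ring.prime l \<Longrightarrow> l dvd a \<Longrightarrow> l dvd b \<Longrightarrow> l dvd N"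
    and kN: "\<And>l. Factorial_Ring.prime l \<Longrightarrow> l dvd k \<Longrightarrow> l dvd N"
  obtains d m where "d dvd N" "d > 0" "m \<noteq> 0" "a = d * m\<^sup>2"
proof -
  have "(y + x) * (y - x) = k * w\<^sup>2" using eq by (simp add: power2_eq_square algebra_simps)
  then have ab': "(\<kappa> * a) * (\<kappa> * b) = k * w\<^sup>2" unfolding ab .
  have "a * (k * b) * \<kappa>\<^sup>2 = k * ((\<kappa> * a) * (\<kappa> * b))" by (simp add: power2_eq_square)
  also have "\<dots> = (k * w)\<^sup>2" unfolding ab' by (simp add: power2_eq_square)
  finally have "a * (k * b) * \<kappa>\<^sup>2 = (k * w)\<^sup>2" .
  moreover have "k * b \<noteq> 0" using ab' nz by auto
  ultimately obtain d m where dm: "d dvd N" "a = d * m\<^sup>2"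
    using square_class[of a "k * b" \<kappa> "k * w" N] nz common kN by (metis less_irrefl prime_dvd_multD)
  have "m \<noteq> 0" "d > 0" using dm(2) nz(4) by (auto simp: zero_less_mult_iff)
  then show ?thesis using that dm by blast
qed

lemma abs_less_square_iff: "\<bar>a\<bar> < \<bar>b\<bar> \<longleftrightarrow> a\<^sup>2 < b\<^sup>2" for a b :: "'a::linordered_idom"
  by (metis abs_le_square_iff not_le)

text \<open>
  The common factor \<open>\<kappa>\<close> is 2 if \<open>p\<close> is odd and 1 if \<open>p\<close> is even. It drops out of the products of two
  of the three sums, and these products are what has to become squares. Separating the two parities
  removes the class of 2 from \<open>d1\<close> and \<open>d3\<close>.
\<close>

lemma concordant_classes:
  fixes p q r s :: int
  assumes cop: "coprime p q" and r: "p\<^sup>2 + 5 * q\<^sup>2 = r\<^sup>2" and s: "p\<^sup>2 + 32 * q\<^sup>2 = s\<^sup>2"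
    and pos: "q \<noteq> 0" "r > 0" "s > 0"
  obtains \<kappa> d1 d2 d3 u v w where "\<kappa> > 0" "d1 > 0" "d2 > 0" "d3 > 0" "d1 dvd 5" "d2 dvd 2" "d3 dvd 3"
    "u \<noteq> 0" "v \<noteq> 0" "w \<noteq> 0"
    "r + p = \<kappa> * d1 * u\<^sup>2" "s + p = \<kappa> * d2 * w\<^sup>2" "s + r = \<kappa> * d3 * v\<^sup>2"
proof -
  have q2: "q\<^sup>2 > 0" using pos by simp
  have e1: "r\<^sup>2 - p\<^sup>2 = 5 * q\<^sup>2" and e2: "s\<^sup>2 - p\<^sup>2 = 32 * q\<^sup>2" and e3: "s\<^sup>2 - r\<^sup>2 = 27 * q\<^sup>2"
    using r s by auto
  have "\<bar>p\<bar> < \<bar>r\<bar>" "\<bar>p\<bar> < \<bar>s\<bar>" unfolding abs_less_square_iff using e1 e2 q2 by linarith+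
  then have gt: "r + p > 0" "s + p > 0" "s + r > 0" using pos by auto
  have pq: False if "Factorial_Ring.prime l" "l dvd p" "l dvd q" for l
    using that cop by (meson coprime_common_divisor not_prime_unit)
  have L1: "l dvd 5" if l: "Factorial_Ring.prime l" "l dvd r" "l dvd p" for l
  proof -
    have "l dvd 5 * q\<^sup>2" unfolding e1[symmetric] using l by (simp add: power2_eq_square)
    then show ?thesis using l pq by (meson prime_dvd_multD prime_dvd_power)
  qed
  have p2: "l dvd 2" if "Factorial_Ring.prime l" "l dvd 32" for l :: int
    using prime_dvd_power[of l 2 5] that by simp
  have p3: "l dvd 3" if "Factorial_Ring.prime l" "l dvd 27" for l :: int
    using prime_dvd_power[of l 3 3] that by simp
  have L2: "l dvd 2" if l: "Factorial_Ring.prime l" "l dvd s" "l dvd p" for l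
  proof -
    have "l dvd 32 * q\<^sup>2" unfolding e2[symmetric] using l by (simp add: power2_eq_square)
    then show ?thesis using l pq p2 by (meson prime_dvd_multD prime_dvd_power)
  qed
  have L3: "l dvd 3" if l: "Factorial_Ring.prime l" "l dvd s" "l dvd r" for l
  proof -
    have "l dvd 27 * q\<^sup>2" unfolding e3[symmetric] using l by (simp add: power2_eq_square)
    then consider "l dvd 27" | "l dvd q" using l by (meson prime_dvd_multD prime_dvd_power)
    then show ?thesis
    proof cases
      case 1 then show ?thesis using p3 l by blast
    next
      case 2
      have "p\<^sup>2 = r * r - 5 * q * q" using r by (simp add: power2_eq_square)
      then have "l dvd p\<^sup>2" using 2 l by simp
      then show ?thesis using pq 2 l prime_dvd_power by blast
    qed
  qed
  have split: "l dvd y" "l dvd x" if "y + x = 2 * a" "y - x = 2 * b" "l dvd a" "l dvd b" for l x y a b :: int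
  proof -
    have "y = a + b" "x = a - b" using that by auto
    then show "l dvd y" "l dvd x" using that(3,4) by simp_all
  qed
  have split': "l dvd y" "l dvd x" if "y + x = 1 * a" "y - x = 1 * b" "l dvd a" "l dvd b"
    "odd a" "Factorial_Ring.prime l" for l x y a b :: int
  proof -
    have "2 * y = a + b" "2 * x = a - b" using that by auto
    then have "l dvd 2 * y" "l dvd 2 * x" using that(3,4) by simp_all
    moreover have "\<not> l dvd 2"
    proof
      assume "l dvd 2"
      then have "l = 2" using that(6) by (intro primes_dvd_imp_eq) simp_all
      then show False using that by simp
    qed
    ultimately show "l dvd y" "l dvd x" using that(6) prime_dvd_multD by blast+
  qed
  from concordant_parity[OF cop r s] show ?thesis
  proof (elim disjE conjE exE)
    assume par: "odd p" "even q" "odd r" "odd s"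
    define a1 b1 a2 b2 a3 b3 where defs: "a1 = (r + p) div 2" "b1 = (r - p) div 2"
      "a2 = (s + p) div 2" "b2 = (s - p) div 2" "a3 = (s + r) div 2" "b3 = (s - r) div 2"
    have ab: "r + p = 2 * a1" "r - p = 2 * b1" "s + p = 2 * a2" "s - p = 2 * b2" "s + r = 2 * a3" "s - r = 2 * b3"
      using par unfolding defs by simp_all
    obtain d1 u where 1: "d1 dvd 5" "d1 > 0" "u \<noteq> 0" "a1 = d1 * u\<^sup>2"
      by (rule sum_class[OF e1 ab(1,2), of 5]) (use pos gt ab split[OF ab(1,2)] L1 in auto)
    obtain d2 w where 2: "d2 dvd 2" "d2 > 0" "w \<noteq> 0" "a2 = d2 * w\<^sup>2"
      by (rule sum_class[OF e2 ab(3,4), of 2]) (use pos gt ab split[OF ab(3,4)] L2 p2 in auto)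
    obtain d3 v where 3: "d3 dvd 3" "d3 > 0" "v \<noteq> 0" "a3 = d3 * v\<^sup>2"
      by (rule sum_class[OF e3 ab(5,6), of 3]) (use pos gt ab split[OF ab(5,6)] L3 p3 in auto)
    show ?thesis by (rule that[of 2 d1 d2 d3 u v w]) (use 1 2 3 ab in auto)
  next
    fix p1 s1 assume ps: "p = 2 * p1" "s = 2 * s1" and par: "odd p1" "odd s1" "odd q" "odd r"
    define a2 b2 where defs: "a2 = (s1 + p1) div 2" "b2 = (s1 - p1) div 2"
    have ab2: "s1 + p1 = 2 * a2" "s1 - p1 = 2 * b2"
      using par unfolding defs by simp_all
    then have ab: "s + p = 4 * a2" "s - p = 4 * b2" unfolding ps by auto
    have sp: "l dvd s" "l dvd p" if "l dvd a2" "l dvd b2" for l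
      using split[OF ab2 that] unfolding ps by auto
    have od: "odd (r + p)" "odd (s + r)" using par ps by auto
    have i: "r + p = 1 * (r + p)" "r - p = 1 * (r - p)" "s + r = 1 * (s + r)" "s - r = 1 * (s - r)" by auto
    have L1': "l dvd 5" if "Factorial_Ring.prime l" "l dvd r + p" "l dvd r - p" for l
      using L1 split'[OF i(1,2) that(2,3) od(1) that(1)] that(1) by blast
    have L3': "l dvd 3" if "Factorial_Ring.prime l" "l dvd s + r" "l dvd s - r" for l
      using L3 split'[OF i(3,4) that(2,3) od(2) that(1)] that(1) by blast
    obtain d1 u where 1: "d1 dvd 5" "d1 > 0" "u \<noteq> 0" "r + p = d1 * u\<^sup>2"
      by (rule sum_class[OF e1 i(1,2), of 5]) (use pos gt L1' in simp_all)
    obtain d2 w where 2: "d2 dvd 2" "d2 > 0" "w \<noteq> 0" "a2 = d2 * w\<^sup>2"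
      by (rule sum_class[OF e2 ab, of 2]) (use pos gt ab sp L2 p2 in auto)
    obtain d3 v where 3: "d3 dvd 3" "d3 > 0" "v \<noteq> 0" "s + r = d3 * v\<^sup>2"
      by (rule sum_class[OF e3 i(3,4), of 3]) (use pos gt L3' p3 in simp_all)
    show ?thesis by (rule that[of 1 d1 d2 d3 u v "2*w"]) (use 1 2 3 ab in \<open>auto simp: power2_eq_square\<close>)
  qed
qed

text \<open>
  With \<open>(\<alpha>, \<beta>, \<gamma>) = (\<epsilon> * p, r, s)\<close> divided by \<open>q\<close>, the halves of the point with abscissa \<open>\<alpha>\<^sup>2\<close> have
  abscissa \<open>(\<alpha> + \<beta>) * (\<alpha> + \<gamma>)\<close>, and the numbers larger by 5 and 32 are \<open>(\<alpha> + \<beta>) * (\<beta> + \<gamma>)\<close> and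
  \<open>(\<alpha> + \<gamma>) * (\<beta> + \<gamma>)\<close>. So all three are squares once the three sums lie in one
  square class. Changing the sign of \<open>p\<close> multiplies the classes of \<open>r + p\<close> and \<open>s + p\<close> by 5 and 2, which
  normalizes the first one; the conics obtained by adding and subtracting the factorizations exclude all
  other classes. The last equation of the conclusion is the duplication formula.
\<close>

lemma concordant_halving:
  fixes p q r s :: int
  assumes cop: "coprime p q" and r: "p\<^sup>2 + 5 * q\<^sup>2 = r\<^sup>2" and s: "p\<^sup>2 + 32 * q\<^sup>2 = s\<^sup>2"
    and pos: "q > 0" "r > 0" "s > 0"
  obtains a b c \<epsilon> :: rat where "a \<noteq> 0" "a\<^sup>2 + 5 = b\<^sup>2" "a\<^sup>2 + 32 = c\<^sup>2" "\<bar>\<epsilon>\<bar> = 1"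
    "(a ^ 4 - 160) * of_int q = 2 * \<epsilon> * of_int p * a * b * c"
proof -
  obtain k d1 d2 d3 u v w where k: "k > 0" and d: "d1 > 0" "d2 > 0" "d3 > 0" "d1 dvd 5" "d2 dvd 2" "d3 dvd 3"
    and nz: "u \<noteq> 0" "v \<noteq> 0" "w \<noteq> 0"
    and eq: "r + p = k * d1 * u\<^sup>2" "s + p = k * d2 * w\<^sup>2" "s + r = k * d3 * v\<^sup>2"
    using concordant_classes[OF cop r s] pos by (metis less_irrefl)
  have dd: "d1 = 1 \<or> d1 = 5" "d2 = 1 \<or> d2 = 2" "d3 = 1 \<or> d3 = 3"
    using d prime_int_iff[of 5] prime_int_iff[of 2] prime_int_iff[of 3] prime5 prime3 two_is_prime_nat by auto
  define K Q P R S V :: rat where defs: "K = of_int k" "Q = of_int q" "P = of_int p" "R = of_int r" "S = of_int s" "V = of_int v"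
  have rat: "R + P = K * of_int d1 * (of_int u)\<^sup>2" "S + P = K * of_int d2 * (of_int w)\<^sup>2"
      "S + R = K * of_int d3 * V\<^sup>2"
    using eq[THEN arg_cong[of _ _ rat_of_int]] unfolding defs by simp_all
  have "P\<^sup>2 + 5 * Q\<^sup>2 = R\<^sup>2" "P\<^sup>2 + 32 * Q\<^sup>2 = S\<^sup>2"
    using r[THEN arg_cong[of _ _ rat_of_int]] s[THEN arg_cong[of _ _ rat_of_int]] unfolding defs by simp_all
  then have prod: "(R + P) * (R - P) = 5 * Q\<^sup>2" "(S + P) * (S - P) = 32 * Q\<^sup>2" "(S + R) * (S - R) = 27 * Q\<^sup>2"
    by (auto simp: power2_eq_square algebra_simps)
  have nzr: "K \<noteq> 0" "Q \<noteq> 0" "V \<noteq> 0" "rat_of_int u \<noteq> 0" "rat_of_int w \<noteq> 0"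
    using k pos nz unfolding defs by auto
  obtain \<epsilon> U W :: rat and e :: int where e: "\<bar>\<epsilon>\<bar> = 1" "U \<noteq> 0" "W \<noteq> 0" "e = 1 \<or> e = 2"
     "R + \<epsilon> * P = K * U\<^sup>2" "S + \<epsilon> * P = K * of_int e * W\<^sup>2"
  proof (cases "d1 = 1")
    case True
    then show ?thesis using that[of 1 "of_int u" "of_int w" d2] rat nzr dd by simp
  next
    case False
    then have d1: "d1 = 5" using dd by blast
    have "K * of_int d1 * (of_int u)\<^sup>2 * (R - P) = 5 * Q\<^sup>2" "K * of_int d2 * (of_int w)\<^sup>2 * (S - P) = 32 * Q\<^sup>2"
      using prod unfolding rat by auto
    then have "R - P = K * (Q / (K * of_int u))\<^sup>2" "S - P = K * (2 / of_int d2) * (4 * Q / (K * of_int w))\<^sup>2"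
      using nzr d d1 by (auto simp: field_simps power2_eq_square)
    moreover have "2 / rat_of_int d2 = of_int (3 - d2)" using dd(2) by auto
    ultimately show ?thesis
      using that[of "-1" "Q / (K * of_int u)" "4 * Q / (K * of_int w)" "3 - d2"] nzr dd(2) by auto
  qed
  define T where "T = Q / (K * U)"
  define M where "M = 3 * Q / (K * of_int d3 * V)"
  have ee: "\<epsilon> * \<epsilon> = 1" using e(1) by (metis abs_mult_self_eq mult_1)
  then have eP: "\<epsilon> * P * (\<epsilon> * P) = P * P" by (metis mult.assoc mult.commute mult_1)
  have prod': "(R + \<epsilon> * P) * (R - \<epsilon> * P) = 5 * Q\<^sup>2" "(S + \<epsilon> * P) * (S - \<epsilon> * P) = 32 * Q\<^sup>2"
    using prod eP by (simp_all add: algebra_simps power2_eq_square)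
  have T: "R - \<epsilon> * P = 5 * K * T\<^sup>2"
    using prod'(1) nzr e(2) unfolding e(5) T_def by (simp add: field_simps power2_eq_square)
  have M: "S - R = 3 * K * of_int d3 * M\<^sup>2"
    using prod(3) nzr d(3) unfolding rat(3) M_def by (simp add: field_simps power2_eq_square)
  have TM: "T \<noteq> 0" "M \<noteq> 0" unfolding T_def M_def using nzr e d by auto
  have "K * (of_int e * W\<^sup>2 - U\<^sup>2) = K * (3 * of_int d3 * M\<^sup>2)"
    using M e(5,6) by (simp add: algebra_simps)
  then have q1: "of_int e * W\<^sup>2 - U\<^sup>2 = 3 * of_int d3 * M\<^sup>2" using nzr(1) by simp
  have "K * (of_int e * W\<^sup>2 + 5 * T\<^sup>2) = K * (of_int d3 * V\<^sup>2)"
    using T rat(3) e(5,6) by (simp add: algebra_simps)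
  then have q2: "of_int e * W\<^sup>2 + 5 * T\<^sup>2 = of_int d3 * V\<^sup>2" using nzr(1) by simp
  have "e = 1 \<and> d3 = 1"
  proof (rule ccontr)
    assume "\<not> ?thesis"
    then consider "e = 2" "d3 = 1" | "e = 2" "d3 = 3" | "e = 1" "d3 = 3" using e(4) dd(3) by blast
    then show False
    proof cases
      case 1 then show False using no_ternary_zero_mod_3[of 2 "-1" W U M] q1 TM by simp
    next
      case 2 then show False using no_ternary_zero_mod_3[of 2 5 W T V] q2 nzr by simp
    next
      case 3 then show False using no_ternary_zero_mod_5[of 3 "-1" W V T] q2 TM by simp
    qed
  qed
  then have f: "R + \<epsilon> * P = K * U\<^sup>2" "S + \<epsilon> * P = K * W\<^sup>2" "S + R = K * V\<^sup>2"
    using e rat by auto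
  show ?thesis
  proof (rule that[of "K * U * W / Q" "K * U * V / Q" "K * W * V / Q" \<epsilon>])
    show "K * U * W / Q \<noteq> 0" using nzr e by simp
    show "\<bar>\<epsilon>\<bar> = 1" by fact
    have A: "(K * U * W / Q)\<^sup>2 = (R + \<epsilon> * P) * (S + \<epsilon> * P) / Q\<^sup>2"
      and B: "(K * U * V / Q)\<^sup>2 = (R + \<epsilon> * P) * (S + R) / Q\<^sup>2"
      and C: "(K * W * V / Q)\<^sup>2 = (S + \<epsilon> * P) * (S + R) / Q\<^sup>2"
      unfolding f by (simp_all add: power2_eq_square field_simps)
    have "(R + \<epsilon> * P) * (S + \<epsilon> * P) + (R + \<epsilon> * P) * (R - \<epsilon> * P) = (R + \<epsilon> * P) * (S + R)"
      by (simp add: algebra_simps)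
    then have "(R + \<epsilon> * P) * (S + \<epsilon> * P) + 5 * Q\<^sup>2 = (R + \<epsilon> * P) * (S + R)" unfolding prod' .
    then show "(K * U * W / Q)\<^sup>2 + 5 = (K * U * V / Q)\<^sup>2"
      unfolding A B using nzr by (simp add: field_simps)
    have "(R + \<epsilon> * P) * (S + \<epsilon> * P) + (S + \<epsilon> * P) * (S - \<epsilon> * P) = (S + \<epsilon> * P) * (S + R)"
      by (simp add: algebra_simps)
    then have "(R + \<epsilon> * P) * (S + \<epsilon> * P) + 32 * Q\<^sup>2 = (S + \<epsilon> * P) * (S + R)" unfolding prod' .
    then show "(K * U * W / Q)\<^sup>2 + 32 = (K * W * V / Q)\<^sup>2"
      unfolding A C using nzr by (simp add: field_simps)
    define m n l where mn: "m = K * U\<^sup>2" "n = K * W\<^sup>2" "l = K * V\<^sup>2"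
    have p160: "160 * Q ^ 4 = m * n * ((R - \<epsilon> * P) * (S - \<epsilon> * P))"
    proof -
      have "160 * Q ^ 4 = (5 * Q\<^sup>2) * (32 * Q\<^sup>2)" by (simp add: power2_eq_square power4_eq_xxxx)
      also have "\<dots> = (m * (R - \<epsilon> * P)) * (n * (S - \<epsilon> * P))" using prod' f unfolding mn by simp
      finally show ?thesis by (simp add: mult_ac)
    qed
    have "m * n - (R - \<epsilon> * P) * (S - \<epsilon> * P) = 2 * \<epsilon> * P * l"
      unfolding mn f[symmetric] by (simp add: algebra_simps)
    then have "(m * n)\<^sup>2 - 160 * Q ^ 4 = m * n * (2 * \<epsilon> * P * l)"
      unfolding p160 by (metis power2_eq_square right_diff_distrib)
    then have "((m * n)\<^sup>2 - 160 * Q ^ 4) / Q ^ 3 = m * n * (2 * \<epsilon> * P * l) / Q ^ 3" by simp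
    moreover have "(K * U * W / Q) ^ 4 = (m * n)\<^sup>2 / Q ^ 4"
      unfolding mn by (simp add: power_mult_distrib power_divide flip: power_mult)
    then have "((K * U * W / Q) ^ 4 - 160) * Q = ((m * n)\<^sup>2 - 160 * Q ^ 4) / Q ^ 3"
      using nzr by (simp add: field_simps power_numeral_reduce)
    moreover have "2 * \<epsilon> * P * (K * U * W / Q) * (K * U * V / Q) * (K * W * V / Q) = m * n * (2 * \<epsilon> * P * l) / Q ^ 3"
      unfolding mn by (simp add: power2_eq_square power3_eq_cube)
    ultimately show "((K * U * W / Q) ^ 4 - 160) * of_int q = 2 * \<epsilon> * of_int p * (K * U * W / Q) * (K * U * V / Q) * (K * W * V / Q)"
      unfolding defs[symmetric] by simp
  qed
qed

section \<open>Infinite descent\<close>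

lemma square_rat_int:
  fixes x :: rat assumes "x\<^sup>2 = of_int n" obtains m where "x = of_int m"
proof -
  obtain m k where mk: "x = of_int m / of_int k" "k > 0" "coprime m k"
    by (metis quotient_of_coprime quotient_of_denom_pos quotient_of_div surj_pair)
  have "(of_int (m\<^sup>2) :: rat) = of_int (n * k\<^sup>2)"
    using assms mk(2) unfolding mk(1) by (simp add: field_simps power2_eq_square)
  then have "m\<^sup>2 = n * k\<^sup>2" by linarith
  then have "k\<^sup>2 dvd m\<^sup>2" by simp
  then have "k dvd m" by (simp add: pow_divides_pow_iff)
  then have "k = 1" using mk by (metis coprime_absorb_right zdvd1_eq abs_of_pos)
  then show ?thesis using that mk by simp
qed

lemma coprime_primesI:
  fixes a b :: int
  assumes "a \<noteq> 0 \<or> b \<noteq> 0" "\<And>l. Factorial_Ring.prime l \<Longrightarrow> l dvd a \<Longrightarrow> l dvd b \<Longrightarrow> False"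
  shows "coprime a b"
proof (rule ccontr)
  assume "\<not> coprime a b"
  then have "\<not> is_unit (gcd a b)" using is_unit_gcd by blast
  moreover have "gcd a b \<noteq> 0" using assms(1) by simp
  ultimately obtain l where "l dvd gcd a b" "Factorial_Ring.prime l" using prime_divisor_exists by blast
  then show False using assms(2) by (metis gcd_dvd1 gcd_dvd2 dvd_trans)
qed

text \<open>
  Doubling \<open>(p, q)\<close> gives the fraction \<open>(p ^ 4 - 160 * q ^ 4) / (2 * p * q * r * s)\<close>. Common
  prime factors can only be 2, 3 and 5. The prime 5 would divide both \<open>p\<close> and \<open>q\<close>; 3 divides each of \<open>r\<close> and \<open>s\<close>
  at most once; the power of 2 in the denominator is 8 if \<open>p\<close> is even, and the numerator is
  odd if \<open>p\<close> is odd. The bound is attained at \<open>(2, 1)\<close>, where the descent has to stop.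
\<close>

lemma concordant_gcd:
  fixes p q r s :: int
  assumes cop: "coprime p q" and r: "p\<^sup>2 + 5 * q\<^sup>2 = r\<^sup>2" and s: "p\<^sup>2 + 32 * q\<^sup>2 = s\<^sup>2"
    and pos: "p > 0" "q > 0" "r > 0" "s > 0"
  shows "gcd (p ^ 4 - 160 * q ^ 4) (2 * p * q * r * s) dvd 72"
proof -
  let ?N = "p ^ 4 - 160 * q ^ 4"
  let ?g = "gcd ?N (2 * p * q * r * s)"
  have pq: False if "Factorial_Ring.prime l" "l dvd p" "l dvd q" for l
    using that cop by (meson coprime_common_divisor not_prime_unit)
  have q4: "l dvd q" if "Factorial_Ring.prime l" "l dvd q ^ 4" for l using that prime_dvd_power by blast
  have p5: "\<not> 5 dvd p"
  proof
    assume 5: "5 dvd p"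
    then have "5 dvd p * p + 5 * q\<^sup>2" by simp
    then have "5 dvd r\<^sup>2" using r by (simp add: power2_eq_square)
    then have "5 dvd r" by (rule prime_dvd_power[OF prime5])
    then obtain a b where "p = 5 * a" "r = 5 * b" using 5 by (auto simp: dvd_def)
    then have "q\<^sup>2 = 5 * (b\<^sup>2 - a\<^sup>2)" using r by (simp add: power2_eq_square)
    then have "5 dvd q\<^sup>2" by (rule dvdI)
    then have "5 dvd q" by (rule prime_dvd_power[OF prime5])
    then show False using pq[of 5] 5 prime5 by blast
  qed
  have r5: "\<not> 5 dvd r"
  proof
    assume "5 dvd r"
    then have "5 dvd r * r - 5 * q\<^sup>2" by simp
    also have "r * r - 5 * q\<^sup>2 = p\<^sup>2" using r by (simp add: power2_eq_square)
    finally show False using p5 prime_dvd_power[OF prime5] by blast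
  qed
  have no9: False if "9 dvd r \<or> 9 dvd s"
  proof -
    have sr: "s\<^sup>2 = r\<^sup>2 + 27 * q\<^sup>2" using r s by simp
    have three: "3 dvd x" if "x * x = 3 * y" for x y :: int
      using that prime_dvd_power[OF prime3, of x 2] by (metis dvd_triv_left power2_eq_square)
    have "3 dvd r \<and> 3 dvd s \<and> (\<exists>c. q * q = 3 * c)" using that
    proof
      assume "9 dvd r"
      then obtain k where k: "r = 9 * k" by (auto simp: dvd_def)
      then have "s * s = 3 * (27 * k\<^sup>2 + 9 * q\<^sup>2)" using sr by (simp add: power2_eq_square)
      then obtain b where b: "s = 3 * b" using three by (metis dvdE)
      then have "b * b = 3 * (3 * k\<^sup>2 + q\<^sup>2)" using sr k by (simp add: power2_eq_square)
      then obtain c where c: "b = 3 * c" using three by (metis dvdE)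
      then have "q * q = 3 * (c * c - k * k)" using sr k b by (simp add: power2_eq_square)
      then have "\<exists>c. q * q = 3 * c" by blast
      then show ?thesis using k b by simp
    next
      assume "9 dvd s"
      then obtain k where k: "s = 9 * k" by (auto simp: dvd_def)
      then have "r * r = 3 * (27 * k\<^sup>2 - 9 * q\<^sup>2)" using sr by (simp add: power2_eq_square)
      then obtain b where b: "r = 3 * b" using three by (metis dvdE)
      then have "b * b = 3 * (3 * k\<^sup>2 - q\<^sup>2)" using sr k by (simp add: power2_eq_square)
      then obtain c where c: "b = 3 * c" using three by (metis dvdE)
      then have "q * q = 3 * (k * k - c * c)" using sr k b by (simp add: power2_eq_square)
      then have "\<exists>c. q * q = 3 * c" by blast
      then show ?thesis using k b by simp
    qed
    then have "3 dvd r" "3 dvd q" using three by auto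
    then have "3 dvd r * r - 5 * (q * q)" by (metis dvd_diff dvd_mult)
    also have "r * r - 5 * (q * q) = p\<^sup>2" using r by (simp add: power2_eq_square)
    finally show False using pq[of 3] \<open>3 dvd q\<close> prime_dvd_power[OF prime3] prime3 by blast
  qed
  have three: "d dvd 3" if d: "d dvd 27" "\<not> 9 dvd d" for d :: int
  proof -
    have "d dvd 3 ^ 3" using d by simp
    then obtain k where k: "k \<le> 3" "normalize d = 3 ^ k" using divides_primepow[OF prime3] by blast
    then have "normalize d = 1 \<or> normalize d = 3 \<or> normalize d = 9 \<or> normalize d = 27"
      by (auto simp: le_Suc_eq numeral_3_eq_3)
    then have "d = 1 \<or> d = -1 \<or> d = 3 \<or> d = -3 \<or> d = 9 \<or> d = -9 \<or> d = 27 \<or> d = -27"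
      by (simp add: abs_if split: if_splits) linarith+
    then show ?thesis using d by (elim disjE) simp_all
  qed
  have dr: "d dvd 3" if d: "d dvd ?N" "d dvd r" for d
  proof -
    have rr: "r * r = p\<^sup>2 + 5 * q\<^sup>2" using r by (simp add: power2_eq_square)
    have "(p\<^sup>2 - 5 * q\<^sup>2) * (r * r) - 135 * q ^ 4 = ?N"
      unfolding rr by (simp add: power2_eq_square power4_eq_xxxx algebra_simps)
    then have "27 * (5 * q ^ 4) = (p\<^sup>2 - 5 * q\<^sup>2) * (r * r) - ?N" by simp
    then have "d dvd 27 * (5 * q ^ 4)" using d by (metis dvd_diff dvd_mult)
    moreover have "coprime d (5 * q ^ 4)"
    proof (rule coprime_primesI)
      show "d \<noteq> 0 \<or> 5 * q ^ 4 \<noteq> 0" using pos by simp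
      fix l assume l: "Factorial_Ring.prime l" "l dvd d" "l dvd 5 * q ^ 4"
      then consider "l dvd 5" | "l dvd q" using prime_dvd_multD q4 by blast
      then show False
      proof cases
        case 1
        then have "l = 5" using l prime5 by (intro primes_dvd_imp_eq)
        then show False using l(2) d(2) r5 dvd_trans by blast
      next
        case 2
        moreover have "l dvd r" using l(2) d(2) dvd_trans by blast
        ultimately have "l dvd r * r - 5 * q * q" by simp
        also have "r * r - 5 * q * q = p\<^sup>2" using r by (simp add: power2_eq_square)
        finally show False using pq 2 l prime_dvd_power by blast
      qed
    qed
    ultimately have "d dvd 27" using coprime_dvd_mult_left_iff by blast
    then show ?thesis using three no9 d by (meson dvd_trans)
  qed
  have ds: "d dvd 3" if d: "d dvd ?N" "d dvd s1" "s1 dvd s" "odd s1" for d s1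
  proof -
    have ss: "s * s = p\<^sup>2 + 32 * q\<^sup>2" using s by (simp add: power2_eq_square)
    have "(p\<^sup>2 - 32 * q\<^sup>2) * (s * s) + 864 * q ^ 4 = ?N"
      unfolding ss by (simp add: power2_eq_square power4_eq_xxxx algebra_simps)
    then have "27 * (32 * q ^ 4) = ?N - (p\<^sup>2 - 32 * q\<^sup>2) * (s * s)" by simp
    moreover have dS: "d dvd s" using d dvd_trans by blast
    ultimately have "d dvd 27 * (32 * q ^ 4)" using d by (metis dvd_diff dvd_mult)
    moreover have "coprime d (32 * q ^ 4)"
    proof (rule coprime_primesI)
      show "d \<noteq> 0 \<or> 32 * q ^ 4 \<noteq> 0" using pos by simp
      fix l assume l: "Factorial_Ring.prime l" "l dvd d" "l dvd 32 * q ^ 4"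
      then consider "l dvd 2 ^ 5" | "l dvd q" using prime_dvd_multD[of l 32] q4 by auto
      then show False
      proof cases
        case 1
        then have "l dvd 2" using l prime_dvd_power by blast
        then have "l = 2" using l by (intro primes_dvd_imp_eq) simp_all
        then show False using l(2) d(2,4) dvd_trans by blast
      next
        case 2
        moreover have "l dvd s" using l(2) dS dvd_trans by blast
        ultimately have "l dvd s * s - 32 * q * q" by simp
        also have "s * s - 32 * q * q = p\<^sup>2" using s by (simp add: power2_eq_square)
        finally show False using pq 2 l prime_dvd_power by blast
      qed
    qed
    ultimately have "d dvd 27" using coprime_dvd_mult_left_iff by blast
    then show ?thesis using three no9 d by (meson dvd_trans)
  qed
  \<comment> \<open>Both parities of \<open>p\<close> at once: \<open>p1\<close> and \<open>s1\<close> are the odd parts of \<open>p\<close> and \<open>s\<close>, and \<open>\<delta>\<close> is 2 or 8.\<close>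
  have main: "?g dvd 72" if f: "2 * p * q * r * s = \<delta> * r * s1 * (p1 * q)" "\<delta> dvd 8" "p1 dvd p" "odd p1" "s1 dvd s" "odd s1"
    for \<delta> p1 s1
  proof -
    have "coprime ?g (p1 * q)"
    proof (rule coprime_primesI)
      show "?g \<noteq> 0 \<or> p1 * q \<noteq> 0" using pos by simp
      fix l assume l: "Factorial_Ring.prime l" "l dvd ?g" "l dvd p1 * q"
      have lN: "l dvd ?N" using l(2) by simp
      consider "l dvd p1" | "l dvd q" using l prime_dvd_multD by blast
      then show False
      proof cases
        case 1
        then have lp: "l dvd p" using f(3) dvd_trans by blast
        have "p ^ 4 - ?N = 2 ^ 5 * (5 * q ^ 4)" by simp
        moreover have "l dvd p ^ 4" using lp by (simp add: power4_eq_xxxx)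
        ultimately have "l dvd 2 ^ 5 * (5 * q ^ 4)" using lN by (metis dvd_diff)
        then consider "l dvd 2" | "l dvd 5" | "l dvd q" using l(1) prime_dvd_multD prime_dvd_power q4 by blast
        then show False
        proof cases
          case 1
          then have "l = 2" using l by (intro primes_dvd_imp_eq) simp_all
          then show False using \<open>l dvd p1\<close> f by simp
        next
          case 2
          then have "l = 5" using l prime5 by (intro primes_dvd_imp_eq)
          then show False using lp p5 by simp
        qed (use pq lp l in blast)
      next
        case 2
        have "?N + 160 * q ^ 4 = p ^ 4" by simp
        moreover have "l dvd 160 * q ^ 4" using 2 by (simp add: power4_eq_xxxx)
        ultimately have "l dvd p ^ 4" using lN by (metis dvd_add)
        then show False using pq 2 l prime_dvd_power by blast
      qed
    qed
    moreover have "?g dvd \<delta> * r * s1 * (p1 * q)" unfolding f(1)[symmetric] by simp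
    ultimately have "?g dvd \<delta> * r * s1" by (simp add: coprime_dvd_mult_left_iff)
    then obtain b s' where 1: "?g = b * s'" "b dvd \<delta> * r" "s' dvd s1" using division_decomp by blast
    then obtain \<delta>' r' where 2: "b = \<delta>' * r'" "\<delta>' dvd \<delta>" "r' dvd r" using division_decomp by blast
    have "s' dvd ?g" "r' dvd ?g" unfolding 1 2 by simp_all
    then have "s' dvd ?N" "r' dvd ?N" by simp_all
    then have "s' dvd 3" "r' dvd 3" using ds[OF _ 1(3) f(5,6)] dr[OF _ 2(3)] by blast+
    moreover have "\<delta>' dvd 8" using dvd_trans[OF 2(2) f(2)] .
    ultimately have "\<delta>' * r' * s' dvd 8 * 3 * 3" by (intro mult_dvd_mono)
    then show ?thesis unfolding 1 2 by simp
  qed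
  from concordant_parity[OF cop r s] show ?thesis
  proof (elim disjE conjE exE)
    assume "odd p" "odd s" then show ?thesis by (intro main[of 2 s p]) simp_all
  next
    fix p1 s1 assume "p = 2 * p1" "s = 2 * s1" "odd p1" "odd s1"
    then show ?thesis by (intro main[of 8 s1 p1]) simp_all
  qed
qed

text \<open>
  The value \<open>36\<close> is exactly the product at \<open>(p, r, s) = (2, 3, 6)\<close>.
\<close>

lemma concordant_product_le:
  fixes p q r s :: int
  assumes cop: "coprime p q" and r: "p\<^sup>2 + 5 * q\<^sup>2 = r\<^sup>2" and s: "p\<^sup>2 + 32 * q\<^sup>2 = s\<^sup>2"
    and pos: "p > 0" "q > 0" "r > 0" "s > 0" and le: "p * r * s \<le> 36"
  shows "p = 2 \<and> q = 1"
proof -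
  have root: "n + 1 \<le> x" if "n\<^sup>2 < x\<^sup>2" "x > 0" for n x :: int
    using that abs_less_square_iff[of n x] by linarith
  have sq: "m\<^sup>2 \<le> x\<^sup>2" if "m \<le> x" "m \<ge> 0" for m x :: int
    using that by (rule power_mono)
  have pr: "a * b * c \<le> p * r * s" if "a \<le> p" "b \<le> r" "c \<le> s" "a \<ge> 0" "b \<ge> 0" "c \<ge> 0" for a b c
    using that by (intro mult_mono) auto
  have p1: "1 \<le> p\<^sup>2" using sq[of 1 p] pos by simp
  have q1: "q = 1" if "p = 2"
  proof (rule ccontr)
    assume "q \<noteq> 1"
    then have q4: "4 \<le> q\<^sup>2" using sq[of 2 q] pos by simp
    have "5 \<le> r" "11 \<le> s" using root[of 4 r] root[of 10 s] r s q4 p1 pos that by auto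
    then show False using pr[of 2 5 11] le that by simp
  qed
  from concordant_parity[OF cop r s] show ?thesis
  proof (elim disjE conjE exE)
    assume "even q"
    then have "2 \<le> q" using pos by presburger
    then have q4: "4 \<le> q\<^sup>2" using sq[of 2 q] by simp
    have "5 \<le> r" "11 \<le> s" using root[of 4 r] root[of 10 s] r s q4 p1 pos by auto
    then show ?thesis using pr[of 1 5 11] le pos by simp
  next
    fix p1 s1 assume e: "p = 2 * p1"
    then have p4: "2 \<le> p" "4 \<le> p\<^sup>2" using pos sq[of 2 p] by auto
    have "0 < q\<^sup>2" using sq[of 1 q] pos by simp
    then have "2\<^sup>2 < r\<^sup>2" "5\<^sup>2 < s\<^sup>2" unfolding power2_eq_square[of 2] power2_eq_square[of 5] using r s p4 by linarith+
    then have "3 \<le> r" "6 \<le> s" using root[of 2 r] root[of 5 s] pos by auto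
    then have "p * 3 * 6 \<le> 36" using pos by (intro order_trans[OF pr le]) simp_all
    then show ?thesis using p4 q1 by simp
  qed
qed

lemma concordant_lowest_terms:
  fixes a b c :: rat
  assumes nz: "a \<noteq> 0" and eq: "a\<^sup>2 + 5 = b\<^sup>2" "a\<^sup>2 + 32 = c\<^sup>2"
  obtains P Q R S :: int where "coprime P Q" "P\<^sup>2 + 5 * Q\<^sup>2 = R\<^sup>2" "P\<^sup>2 + 32 * Q\<^sup>2 = S\<^sup>2"
    "P > 0" "Q > 0" "R > 0" "S > 0"
    "\<bar>a\<bar> * of_int Q = of_int P" "\<bar>b\<bar> * of_int Q = of_int R" "\<bar>c\<bar> * of_int Q = of_int S"
proof -
  obtain P Q where PQ: "\<bar>a\<bar> = of_int P / of_int Q" "Q > 0" "coprime P Q"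
    by (metis quotient_of_coprime quotient_of_denom_pos quotient_of_div surj_pair)
  have aQ: "\<bar>a\<bar> * of_int Q = of_int P" using PQ by simp
  have P: "P > 0" using aQ PQ(2) nz by (metis of_int_0_less_iff zero_less_abs_iff zero_less_mult_iff)
  have aQ2: "a\<^sup>2 * (of_int Q)\<^sup>2 = (of_int P)\<^sup>2" unfolding aQ[symmetric] by (simp add: power_mult_distrib)
  have sq: "(\<bar>b\<bar> * of_int Q)\<^sup>2 = of_int (P\<^sup>2 + 5 * Q\<^sup>2)" "(\<bar>c\<bar> * of_int Q)\<^sup>2 = of_int (P\<^sup>2 + 32 * Q\<^sup>2)"
    unfolding power_mult_distrib power2_abs eq[symmetric] using aQ2 by (simp_all add: distrib_right)
  obtain R S where RS: "\<bar>b\<bar> * of_int Q = of_int R" "\<bar>c\<bar> * of_int Q = of_int S"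
    using square_rat_int[OF sq(1)] square_rat_int[OF sq(2)] by metis
  have "of_int (R\<^sup>2) = (of_int (P\<^sup>2 + 5 * Q\<^sup>2) :: rat)" "of_int (S\<^sup>2) = (of_int (P\<^sup>2 + 32 * Q\<^sup>2) :: rat)"
    unfolding sq[symmetric] RS by simp_all
  then have R: "P\<^sup>2 + 5 * Q\<^sup>2 = R\<^sup>2" and S: "P\<^sup>2 + 32 * Q\<^sup>2 = S\<^sup>2"
    unfolding of_int_eq_iff by simp_all
  have "0 < R\<^sup>2" "0 < S\<^sup>2" unfolding R[symmetric] S[symmetric] using P PQ(2) by (simp_all add: add_pos_pos)
  then have "R \<noteq> 0" "S \<noteq> 0" by auto
  moreover have "0 \<le> (of_int R :: rat)" "0 \<le> (of_int S :: rat)" unfolding RS[symmetric] using PQ(2) by simp_all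
  ultimately have "R > 0" "S > 0" by auto
  then show ?thesis using that PQ(2,3) R S P aQ RS by blast
qed

text \<open>
  If \<open>(P, Q)\<close> is a half of \<open>(p, q)\<close>, the bound on the cancellation gives \<open>Q * P * R * S \<le> 36 * q\<close>. Hence
  either \<open>P * R * S \<le> 36\<close> and the half is \<open>(2, 1)\<close>, or \<open>Q < q\<close> and the half is \<open>(2, 1)\<close> by induction. The
  double of \<open>(2, 1)\<close> is \<open>(2, 1)\<close> again.
\<close>

theorem concordant_unique:
  fixes p q r s :: int
  assumes "coprime p q" and "p\<^sup>2 + 5 * q\<^sup>2 = r\<^sup>2" and "p\<^sup>2 + 32 * q\<^sup>2 = s\<^sup>2"
    and "p > 0" "q > 0" "r > 0" "s > 0"
  shows "p = 2 \<and> q = 1"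
  using assms
proof (induction "nat q" arbitrary: p q r s rule: less_induct)
  case less
  note r = less.prems(2) and s = less.prems(3) and pos = less.prems(4-)
  obtain a b c \<epsilon> :: rat where abc: "a \<noteq> 0" "a\<^sup>2 + 5 = b\<^sup>2" "a\<^sup>2 + 32 = c\<^sup>2" "\<bar>\<epsilon>\<bar> = 1"
    "(a ^ 4 - 160) * of_int q = 2 * \<epsilon> * of_int p * a * b * c"
    using concordant_halving[OF less.prems(1-3) pos(2-4)] .
  obtain P Q R S where PQ: "coprime P Q" "P\<^sup>2 + 5 * Q\<^sup>2 = R\<^sup>2" "P\<^sup>2 + 32 * Q\<^sup>2 = S\<^sup>2"
    "P > 0" "Q > 0" "R > 0" "S > 0"
    and aQ: "\<bar>a\<bar> * of_int Q = of_int P" and RS': "\<bar>b\<bar> * of_int Q = of_int R" "\<bar>c\<bar> * of_int Q = of_int S"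
    using concordant_lowest_terms[OF abc(1-3)] .
  have aQ2: "a\<^sup>2 * (of_int Q)\<^sup>2 = (of_int P)\<^sup>2" unfolding aQ[symmetric] by (simp add: power_mult_distrib)
  let ?N = "P ^ 4 - 160 * Q ^ 4"
  have "\<bar>(a ^ 4 - 160) * of_int q\<bar> * (of_int Q) ^ 4 =
      2 * of_int p * (\<bar>a\<bar> * of_int Q) * (\<bar>b\<bar> * of_int Q) * (\<bar>c\<bar> * of_int Q) * of_int Q"
    unfolding abc(5) using pos PQ(5) abc(4) by (simp add: abs_mult power4_eq_xxxx)
  also have "\<dots> = of_int (2 * p * P * R * S * Q)"
    unfolding aQ RS' by simp
  also have "\<bar>(a ^ 4 - 160) * of_int q\<bar> * (of_int Q) ^ 4 = \<bar>(a\<^sup>2 * (of_int Q)\<^sup>2)\<^sup>2 - 160 * (of_int Q) ^ 4\<bar> * of_int q"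
  proof -
    have "(a\<^sup>2 * (of_int Q)\<^sup>2)\<^sup>2 - 160 * (of_int Q) ^ 4 = (a ^ 4 - 160) * (of_int Q) ^ 4"
      by (simp add: power_mult_distrib left_diff_distrib flip: power_mult)
    then show ?thesis using pos PQ(5) by (simp add: abs_mult)
  qed
  also have "\<dots> = of_int (\<bar>?N\<bar> * q)" unfolding aQ2 by (simp flip: power_mult)
  finally have N: "\<bar>?N\<bar> * q = 2 * p * P * R * S * Q" by (simp only: of_int_eq_iff)
  let ?D = "2 * P * Q * R * S"
  have "\<bar>q * ?N\<bar> = p * ?D" using N pos by (simp add: abs_mult mult_ac)
  then have "?D dvd q * ?N" by (metis dvd_abs_iff dvd_triv_right)
  then have "?D dvd gcd (q * ?N) (q * ?D)" by simp
  also have "gcd (q * ?N) (q * ?D) = q * gcd ?N ?D" using gcd_mult_distrib_int[of q ?N ?D] pos by simp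
  also have "\<dots> dvd q * 72" by (intro mult_dvd_mono dvd_refl concordant_gcd PQ)
  finally have "?D \<le> q * 72" using pos by (intro zdvd_imp_le) auto
  then have bound: "Q * (P * R * S) \<le> q * 36" by (simp add: mult_ac)
  have PQ21: "P = 2 \<and> Q = 1"
  proof (cases "P * R * S \<le> 36")
    case True
    then show ?thesis using concordant_product_le[OF PQ] by blast
  next
    case False
    then have "Q * 36 < Q * (P * R * S)" using PQ(5) by simp
    then have "Q < q" using bound by linarith
    then show ?thesis using less.hyps[of Q P R S] PQ by simp
  qed
  have "R\<^sup>2 = 3\<^sup>2" "S\<^sup>2 = 6\<^sup>2" using PQ(2,3) PQ21 by auto
  then have "R = 3" "S = 6" using PQ(6,7) by (auto simp only: power2_eq_iff)
  then have p2: "p = 2 * q" using N PQ21 by simp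
  then have "q dvd 1" using less.prems(1) by (metis coprime_common_divisor dvd_triv_right dvd_refl)
  then show ?case using p2 pos by simp
qed

corollary all_shifts_square:
  fixes x a b c :: rat
  assumes x: "x = a\<^sup>2" "x + 5 = b\<^sup>2" "x + 32 = c\<^sup>2" "x \<noteq> 0"
  shows "x = 4"
proof -
  have "a \<noteq> 0" "a\<^sup>2 + 5 = b\<^sup>2" "a\<^sup>2 + 32 = c\<^sup>2" using x by auto
  then obtain P Q R S where PQ: "coprime P Q" "P\<^sup>2 + 5 * Q\<^sup>2 = R\<^sup>2" "P\<^sup>2 + 32 * Q\<^sup>2 = S\<^sup>2"
    "P > 0" "Q > 0" "R > 0" "S > 0" and aQ: "\<bar>a\<bar> * of_int Q = of_int P"
    by (rule concordant_lowest_terms)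
  then have "\<bar>a\<bar> = 2" using concordant_unique[OF PQ] by simp
  moreover have "x = \<bar>a\<bar>\<^sup>2" using x(1) by simp
  ultimately show ?thesis by simp
qed

section \<open>Rational points of the split cubic\<close>

text \<open>
  In lowest terms, primes that two of \<open>x\<close>, \<open>x + 5\<close>, \<open>x + 32\<close> share divide a difference, 5, 32 or 27.
\<close>

lemma point_classes:
  fixes x y :: rat
  assumes eq: "x * (x + 5) * (x + 32) = y\<^sup>2" and y: "y \<noteq> 0"
  obtains d1 d2 d3 :: int and u v w :: rat where "d1 dvd 10" "d2 dvd 15" "d3 dvd 6"
    "x = of_int d1 * u\<^sup>2" "x + 5 = of_int d2 * v\<^sup>2" "x + 32 = of_int d3 * w\<^sup>2"
proof -
  obtain m n where mn: "x = of_int m / of_int n" "n > 0" "coprime m n"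
    by (metis quotient_of_coprime quotient_of_denom_pos quotient_of_div surj_pair)
  let ?a = "m + 5 * n" and ?b = "m + 32 * n"
  have xn: "x * of_int n = of_int m" "(x + 5) * of_int n = of_int ?a" "(x + 32) * of_int n = of_int ?b"
    using mn by (simp_all add: distrib_right)
  have "(y * (of_int n)\<^sup>2)\<^sup>2 = (x * of_int n) * ((x + 5) * of_int n) * ((x + 32) * of_int n) * of_int n"
    unfolding power_mult_distrib eq[symmetric] by (simp add: power2_eq_square)
  also have "\<dots> = of_int (m * ?a * ?b * n)" unfolding xn by simp
  finally have sq: "(y * (of_int n)\<^sup>2)\<^sup>2 = of_int (m * ?a * ?b * n)" .
  then obtain c where "y * (of_int n)\<^sup>2 = of_int c" by (rule square_rat_int)
  with sq have "of_int (c\<^sup>2) = (of_int (m * ?a * ?b * n) :: rat)" by simp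
  then have c: "c\<^sup>2 = m * ?a * ?b * n" by (simp only: of_int_eq_iff)
  have nz: "m \<noteq> 0" "?a \<noteq> 0" "?b \<noteq> 0" "n \<noteq> 0"
  proof -
    have "x \<noteq> 0" "x + 5 \<noteq> 0" "x + 32 \<noteq> 0" using eq y by (metis mult_zero_left mult_zero_right power_eq_0_iff)+
    then have "x * of_int n \<noteq> 0" "(x + 5) * of_int n \<noteq> 0" "(x + 32) * of_int n \<noteq> 0" using mn(2) by simp_all
    then show "m \<noteq> 0" "?a \<noteq> 0" "?b \<noteq> 0" "n \<noteq> 0" unfolding xn using mn(2) by simp_all
  qed
  have mnF: False if "Factorial_Ring.prime l" "l dvd m" "l dvd n" for l
    using that mn(3) by (meson coprime_common_divisor not_prime_unit)
  have p2: "l dvd 2" if "Factorial_Ring.prime l" "l dvd 32" for l :: int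
    using prime_dvd_power[of l 2 5] that by simp
  have p3: "l dvd 3" if "Factorial_Ring.prime l" "l dvd 27" for l :: int
    using prime_dvd_power[of l 3 3] that by simp
  have ab: "l dvd 5" if "Factorial_Ring.prime l" "l dvd m" "l dvd ?a" for l
  proof -
    have "l dvd 5 * n" using that dvd_add_right_iff by blast
    then show ?thesis using that mnF prime_dvd_multD by blast
  qed
  have ac: "l dvd 2" if "Factorial_Ring.prime l" "l dvd m" "l dvd ?b" for l
  proof -
    have "l dvd 32 * n" using that dvd_add_right_iff by blast
    then show ?thesis using that mnF p2 prime_dvd_multD by blast
  qed
  have an: False if "Factorial_Ring.prime l" "l dvd n" "l dvd ?a \<or> l dvd ?b" for l
  proof -
    have "l dvd m" using that(2,3) by (auto simp: dvd_add_left_iff)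
    then show False using that mnF by blast
  qed
  have bc: "l dvd 3" if "Factorial_Ring.prime l" "l dvd ?a" "l dvd ?b" for l
  proof -
    have "l dvd ?b - ?a" using that(2,3) by (rule dvd_diff[rotated])
    then have "l dvd 27 * n" by simp
    then have "l dvd 27 \<or> l dvd n" using that(1) prime_dvd_multD by blast
    then show ?thesis using that p3 an by blast
  qed
  have s6: "l dvd 6" if "l dvd 2 \<or> l dvd 3" for l :: int
    using that dvd_mult2[of l 2 3] dvd_mult[of l 3 2] by auto
  have s10: "l dvd 10" if "l dvd 2 \<or> l dvd 5" for l :: int
    using that dvd_mult2[of l 2 5] dvd_mult[of l 5 2] by auto
  have s15: "l dvd 15" if "l dvd 3 \<or> l dvd 5" for l :: int
    using that dvd_mult2[of l 3 5] dvd_mult[of l 5 3] by auto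
  have spl: "l dvd f \<or> l dvd g \<or> l dvd h" if "Factorial_Ring.prime l" "l dvd f * g * h" for l f g h :: int
    using that prime_dvd_multD by blast
  obtain d0 e where e: "d0 dvd 1" "n = d0 * e\<^sup>2"
  proof (rule square_class[of n "m * ?a * ?b" 1 c 1])
    fix l assume "Factorial_Ring.prime l" "l dvd n" "l dvd m * ?a * ?b"
    then show "l dvd 1" using spl[of l m ?a ?b] mnF an by blast
  qed (use c nz in auto)
  have d0: "d0 = 1"
    using e mn(2) by (auto simp: zdvd1_eq abs_if zero_less_mult_iff split: if_splits)
  have e0: "e \<noteq> 0" "(of_int n :: rat) = (of_int e)\<^sup>2" using e d0 mn(2) by auto
  obtain d1 u where 1: "d1 dvd 10" "m = d1 * u\<^sup>2"
  proof (rule square_class[of m "?a * ?b * n" 1 c 10])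
    fix l assume l: "Factorial_Ring.prime l" "l dvd m" "l dvd ?a * ?b * n"
    then show "l dvd 10" using spl[OF l(1,3)] mnF ab ac s10 by blast
  qed (use c nz in auto)
  obtain d2 v where 2: "d2 dvd 15" "?a = d2 * v\<^sup>2"
  proof (rule square_class[of ?a "m * ?b * n" 1 c 15])
    fix l assume l: "Factorial_Ring.prime l" "l dvd ?a" "l dvd m * ?b * n"
    then show "l dvd 15" using spl[OF l(1,3)] an ab bc s15 by blast
  qed (use c nz in auto)
  obtain d3 w where 3: "d3 dvd 6" "?b = d3 * w\<^sup>2"
  proof (rule square_class[of ?b "m * ?a * n" 1 c 6])
    fix l assume l: "Factorial_Ring.prime l" "l dvd ?b" "l dvd m * ?a * n"
    then show "l dvd 6" using spl[OF l(1,3)] an ac bc s6 by blast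
  qed (use c nz in auto)
  have scale: "z = of_int d * (of_int k / of_int e)\<^sup>2" if "z * of_int n = of_int (d * k\<^sup>2)" for z :: rat and d k
    using that e0 by (simp add: field_simps)
  show ?thesis
  proof (rule that[OF 1(1) 2(1) 3(1)])
    show "x = of_int d1 * (of_int u / of_int e)\<^sup>2" by (rule scale) (simp only: xn(1) 1(2))
    show "x + 5 = of_int d2 * (of_int v / of_int e)\<^sup>2" by (rule scale) (simp only: xn(2) 2(2))
    show "x + 32 = of_int d3 * (of_int w / of_int e)\<^sup>2" by (rule scale) (simp only: xn(3) 3(2))
  qed
qed

lemma square_class_product:
  fixes d1 d2 d3 k :: int
  assumes "d1 = 1 \<or> d1 = 2" "d2 = 1 \<or> d2 = 3 \<or> d2 = 5 \<or> d2 = 15" "d3 = 1 \<or> d3 = 2 \<or> d3 = 3 \<or> d3 = 6"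
    and "k\<^sup>2 = d1 * d2 * d3"
  shows "d1 = 1 \<and> d2 = 1 \<and> d3 = 1 \<or> d1 = 2 \<and> d2 = 1 \<and> d3 = 2 \<or> d1 = 1 \<and> d2 = 3 \<and> d3 = 3 \<or> d1 = 2 \<and> d2 = 3 \<and> d3 = 6"
proof -
  have "d1 * d2 * d3 < 14\<^sup>2" using assms(1-3) by auto
  then have "\<bar>k\<bar> < 14" using assms(4) abs_less_square_iff[of k 14] by simp
  moreover define a where "a = \<bar>k\<bar>"
  ultimately have "a = 0 \<or> a = 1 \<or> a = 2 \<or> a = 3 \<or> a = 4 \<or> a = 5 \<or> a = 6 \<or> a = 7 \<or> a = 8 \<or> a = 9 \<or>
    a = 10 \<or> a = 11 \<or> a = 12 \<or> a = 13" by presburger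
  moreover have "a\<^sup>2 = d1 * d2 * d3" using assms(4) a_def by simp
  ultimately have "d1 * d2 * d3 \<in> {0,1,4,9,16,25,36,49,64,81,100,121,144,169}"
    by (elim disjE) simp_all
  then show ?thesis using assms(1-3) by (elim disjE) simp_all
qed

lemma positive_divisors:
  fixes d :: int assumes "d > 0"
  shows "d dvd 10 \<Longrightarrow> d = 1 \<or> d = 2 \<or> d = 5 \<or> d = 10"
    and "d dvd 15 \<Longrightarrow> d = 1 \<or> d = 3 \<or> d = 5 \<or> d = 15"
    and "d dvd 6 \<Longrightarrow> d = 1 \<or> d = 2 \<or> d = 3 \<or> d = 6"
proof -
  have le: "d dvd n \<Longrightarrow> 0 < n \<Longrightarrow> d \<le> n" for n by (rule zdvd_imp_le)
  { assume h: "d dvd 10"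
    then have "d \<le> 10" using le by simp
    with assms have "d = 1 \<or> d = 2 \<or> d = 3 \<or> d = 4 \<or> d = 5 \<or> d = 6 \<or> d = 7 \<or> d = 8 \<or> d = 9 \<or> d = 10"
      by presburger
    then show "d = 1 \<or> d = 2 \<or> d = 5 \<or> d = 10" using h by (elim disjE) simp_all }
  { assume h: "d dvd 15"
    then have "d \<le> 15" using le by simp
    with assms have "d = 1 \<or> d = 2 \<or> d = 3 \<or> d = 4 \<or> d = 5 \<or> d = 6 \<or> d = 7 \<or> d = 8 \<or> d = 9 \<or> d = 10
        \<or> d = 11 \<or> d = 12 \<or> d = 13 \<or> d = 14 \<or> d = 15"
      by presburger
    then show "d = 1 \<or> d = 3 \<or> d = 5 \<or> d = 15" using h by (elim disjE) simp_all }
  { assume h: "d dvd 6"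
    then have "d \<le> 6" using le by simp
    with assms have "d = 1 \<or> d = 2 \<or> d = 3 \<or> d = 4 \<or> d = 5 \<or> d = 6" by presburger
    then show "d = 1 \<or> d = 2 \<or> d = 3 \<or> d = 6" using h by (elim disjE) simp_all }
qed

text \<open>
  After the condition that the product of the three classes is a square, the classes \<open>(d, d2, d3)\<close>
  that remain are \<open>(1, 1, 1)\<close>, \<open>(2, 1, 2)\<close>, \<open>(1, 3, 3)\<close>, \<open>(2, 3, 6)\<close>. The last three are excluded by a conic that has
  no points modulo 5, 5 and 3.
\<close>

lemma small_class_point:
  fixes x y u :: rat and d :: int
  assumes eq: "x * (x + 5) * (x + 32) = y\<^sup>2" and x: "x > 0" and d: "d = 1 \<or> d = 2" "x = of_int d * u\<^sup>2"
  shows "x = 4"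
proof -
  have "x * (x + 5) * (x + 32) > 0" using x by simp
  then have y: "y \<noteq> 0" using eq by auto
  obtain d1 d2 d3 :: int and z v w :: rat where dd: "d1 dvd 10" "d2 dvd 15" "d3 dvd 6"
    "x = of_int d1 * z\<^sup>2" "x + 5 = of_int d2 * v\<^sup>2" "x + 32 = of_int d3 * w\<^sup>2"
    by (rule point_classes[OF eq y])
  have "0 < of_int d2 * v\<^sup>2" "0 < of_int d3 * w\<^sup>2"
    unfolding dd(5,6)[symmetric] using x by simp_all
  then have pos: "d2 > 0" "d3 > 0" "v \<noteq> 0" "w \<noteq> 0" and u: "u \<noteq> 0"
    using x d by (auto simp: zero_less_mult_iff)
  have "of_int (d * d2 * d3) * (u * v * w)\<^sup>2 = (of_int d * u\<^sup>2) * (of_int d2 * v\<^sup>2) * (of_int d3 * w\<^sup>2)"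
    by (simp add: power_mult_distrib)
  also have "\<dots> = y\<^sup>2" unfolding d(2)[symmetric] dd(5,6)[symmetric] by (rule eq)
  finally have "(y / (u * v * w))\<^sup>2 = of_int (d * d2 * d3)"
    using pos u by (simp add: power_divide divide_eq_eq)
  moreover from this obtain k where "y / (u * v * w) = of_int k" by (rule square_rat_int)
  ultimately have "of_int (k\<^sup>2) = (of_int (d * d2 * d3) :: rat)" by simp
  then have k: "k\<^sup>2 = d * d2 * d3" by (simp only: of_int_eq_iff)
  consider "d = 1" "d2 = 1" "d3 = 1" | "d = 2" "d2 = 1" | "d = 1" "d2 = 3" | "d = 2" "d3 = 6"
    using square_class_product[OF d(1) positive_divisors(2)[OF pos(1) dd(2)] positive_divisors(3)[OF pos(2) dd(3)] k] by blast
  then show ?thesis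
  proof cases
    case 1
    then show ?thesis using all_shifts_square[of x u v w] d dd x by simp
  next
    case 2
    then have "v\<^sup>2 - of_int 2 * u\<^sup>2 = 5 * of_int 1 * 1\<^sup>2" using d(2) dd(5) by simp
    from no_ternary_zero_mod_5[OF _ _ this] show ?thesis by simp
  next
    case 3
    then have "u\<^sup>2 - of_int 3 * v\<^sup>2 = 5 * of_int (-1) * 1\<^sup>2" using d(2) dd(5) by simp
    from no_ternary_zero_mod_5[OF _ _ this] show ?thesis by simp
  next
    case 4
    then have "of_int 1 * u\<^sup>2 + of_int 1 * 4\<^sup>2 = 3 * w\<^sup>2" using d(2) dd(6) by simp
    from no_ternary_zero_mod_3[OF _ _ this] show ?thesis using pos by simp
  qed
qed

text \<open>
  Translation by the 2-torsion point \<open>(0, 0)\<close>, that is \<open>x \<mapsto> 160 / x\<close>, removes the factor 5 from the class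
  of \<open>x\<close>.
\<close>

lemma positive_point:
  fixes x y :: rat
  assumes eq: "x * (x + 5) * (x + 32) = y\<^sup>2" and x: "x > 0"
  shows "x = 4 \<or> x = 40"
proof -
  have "x * (x + 5) * (x + 32) > 0" using x by simp
  then have y: "y \<noteq> 0" using eq by auto
  obtain d1 d2 d3 :: int and u v w :: rat where dd: "d1 dvd 10" "d2 dvd 15" "d3 dvd 6"
    "x = of_int d1 * u\<^sup>2" "x + 5 = of_int d2 * v\<^sup>2" "x + 32 = of_int d3 * w\<^sup>2"
    by (rule point_classes[OF eq y])
  have "d1 > 0" "u \<noteq> 0" using x dd(4) by (auto simp: zero_less_mult_iff)
  then consider "d1 = 1 \<or> d1 = 2" | "d1 = 5 \<or> d1 = 10" using positive_divisors(1)[of d1] dd by blast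
  then show ?thesis
  proof cases
    case 1
    then show ?thesis using small_class_point[OF eq x] dd by blast
  next
    case 2
    define t where "t = 160 / x"
    have t: "t > 0" unfolding t_def using x by simp
    have t5: "t + 5 = 5 * (x + 32) / x" and t32: "t + 32 = 32 * (x + 5) / x"
      unfolding t_def using x by (simp_all add: add_divide_distrib distrib_left)
    have expand: "160 / x * (5 * b / x) * (32 * a / x) = 160\<^sup>2 * (x * a * b) / x ^ 4" for a b
      using x by (simp add: field_simps power4_eq_xxxx)
    have "t * (t + 5) * (t + 32) = 160\<^sup>2 * (x * (x + 5) * (x + 32)) / x ^ 4"
      unfolding t5 t32 unfolding t_def by (rule expand)
    also have "\<dots> = (160 * y / x\<^sup>2)\<^sup>2" unfolding eq by (simp add: power_divide power_mult_distrib flip: power_mult)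
    finally have et: "t * (t + 5) * (t + 32) = (160 * y / x\<^sup>2)\<^sup>2" .
    have "\<exists>d::int. \<exists>s. (d = 1 \<or> d = 2) \<and> t = of_int d * s\<^sup>2"
      using 2
    proof
      assume "d1 = 5"
      then show ?thesis using \<open>u \<noteq> 0\<close> unfolding t_def dd(4)
        by (intro exI[of _ 2] exI[of _ "4 / u"]) (simp add: field_simps)
    next
      assume "d1 = 10"
      then show ?thesis using \<open>u \<noteq> 0\<close> unfolding t_def dd(4)
        by (intro exI[of _ 1] exI[of _ "4 / u"]) (simp add: field_simps)
    qed
    then have "t = 4" using small_class_point[OF et t] by blast
    then show ?thesis unfolding t_def using x by (simp add: field_simps)
  qed
qed

text \<open>
  A negative \<open>x\<close> lies on the bounded component, and translation by the 2-torsion point \<open>(-5, 0)\<close> moves it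
  to the unbounded one.
\<close>

theorem split_cubic_points:
  fixes x y :: rat
  assumes eq: "x * (x + 5) * (x + 32) = y\<^sup>2"
  shows "x \<in> {0, -5, -32, 4, 40, -8, -20}"
proof (cases "y = 0")
  case True
  then show ?thesis using eq by (auto simp: add_eq_0_iff)
next
  case y: False
  show ?thesis
  proof (cases "x > 0")
    case True
    then show ?thesis using positive_point[OF eq] by auto
  next
    case False
    have "x * (x + 5) * (x + 32) > 0" using eq y by simp
    with False have r: "x < 0" "x + 5 < 0" "x + 32 > 0"
      by (auto simp: zero_less_mult_iff mult_less_0_iff)
    define z where "z = x + 5"
    define t where "t = - 5 * (x + 32) / z"
    have z: "z < 0" using r z_def by simp
    then have t: "t > 0" unfolding t_def using r by (intro divide_neg_neg) simp_all
    have t5: "t + 5 = - 135 / z" and t32: "t + 32 = 27 * x / z"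
      unfolding t_def using z by (simp_all add: z_def field_simps)
    have expand: "- 5 * b / z * (- 135 / z) * (27 * a / z) = 135\<^sup>2 * (a * z * b) / z ^ 4" for a b
      using z by (simp add: field_simps power4_eq_xxxx)
    have "t * (t + 5) * (t + 32) = 135\<^sup>2 * (x * z * (x + 32)) / z ^ 4"
      unfolding t5 t32 unfolding t_def by (rule expand)
    also have "\<dots> = (135 * y / z\<^sup>2)\<^sup>2"
      using eq unfolding z_def by (simp add: power_divide power_mult_distrib flip: power_mult)
    finally have "t = 4 \<or> t = 40" using positive_point t by blast
    then have "z = -135 / 9 \<or> z = -135 / 45" using t5 z by (auto simp: field_simps)
    then show ?thesis unfolding z_def by auto
  qed
qed

section \<open>Evaluation of the defining forms\<close>

lemma map_poly_add_hom:
  assumes "h 0 = 0" "\<And>a b. h (a + b) = h a + h b"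
  shows "map_poly h (p + q) = map_poly h p + map_poly h q"
  by (rule poly_eqI) (simp add: coeff_map_poly assms)

lemma poly_map_poly_mult:
  fixes h :: "'a::comm_semiring_0 \<Rightarrow> 'b::comm_semiring_0"
  assumes h: "h 0 = 0" "\<And>a b. h (a + b) = h a + h b" "\<And>a b. h (a * b) = h a * h b"
  shows "poly (map_poly h (p * q)) x = poly (map_poly h p) x * poly (map_poly h q) x"
proof (induction p)
  case (pCons a p)
  have "map_poly h (smult a q) = smult (h a) (map_poly h q)"
    by (rule poly_eqI) (simp add: coeff_map_poly h)
  then show ?case
    using pCons by (simp add: map_poly_add_hom map_poly_pCons h algebra_simps)
qed simp

lemma eval1_hom [simp]:
  "eval1 0 x = 0" "eval1 1 x = 1" "eval1 (p + q) x = eval1 p x + eval1 q x" "eval1 (p * q) x = eval1 p x * eval1 q x"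
  "eval1 (pCons a p) x = of_rat a + x * eval1 p x"
  unfolding eval1_def
  by (simp_all add: map_poly_add_hom of_rat_add poly_map_poly_mult of_rat_mult map_poly_pCons)

lemma eval2_hom [simp]:
  "eval2 0 x y = 0" "eval2 1 x y = 1" "eval2 (p + q) x y = eval2 p x y + eval2 q x y"
  "eval2 (p * q) x y = eval2 p x y * eval2 q x y" "eval2 (pCons a p) x y = eval1 a x + y * eval2 p x y"
  unfolding eval2_def by (simp_all add: map_poly_add_hom poly_map_poly_mult map_poly_pCons)

lemma eval2_minus [simp]: "eval2 (- p) x y = - eval2 p x y"
  using eval2_hom(3)[of p "- p" x y] by (simp add: eq_neg_iff_add_eq_0 add.commute)

lemma eval2_smult [simp]: "eval2 (Polynomial.smult c p) x y = eval1 c x * eval2 p x y"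
  using eval2_hom(4)[of "[:c:]" p x y] by simp

lemma eval2_ring [simp]:
  "eval2 (p - q) x y = eval2 p x y - eval2 q x y" "eval2 (p ^ n) x y = eval2 p x y ^ n"
  "eval2 (numeral k) x y = numeral k" "eval2 var_x x y = x" "eval2 var_y x y = y"
proof -
  show "eval2 (p - q) x y = eval2 p x y - eval2 q x y"
    using eval2_hom(3)[of p "- q"] by simp
  show "eval2 (p ^ n) x y = eval2 p x y ^ n" by (induction n) simp_all
  show "eval2 (numeral k) x y = numeral k" by (simp add: numeral_poly)
qed (simp_all add: var_x_def var_y_def)

lemma eval3_add [simp]: "eval3 (p + q) x y z = eval3 p x y z + eval3 q x y z" and eval3_0 [simp]: "eval3 0 x y z = 0"
  unfolding eval3_def by (simp_all add: map_poly_add_hom)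

text \<open>
  The homogenizations are handled as sums of monomials, on which evaluation and the partial derivatives act termwise.
\<close>

definition mono3 :: "rat \<Rightarrow> nat \<Rightarrow> nat \<Rightarrow> nat \<Rightarrow> rat poly poly poly" where
  "mono3 c i j k = Polynomial.monom (Polynomial.monom (Polynomial.monom c i) j) k"

lemma eval3_mono3 [simp]: "eval3 (mono3 c i j k) x y z = of_rat c * x ^ i * y ^ j * z ^ k"
  unfolding mono3_def eval3_def eval2_def eval1_def by (simp add: map_poly_monom poly_monom)

lemma mono3_0 [simp]: "mono3 0 i j k = 0"
  by (simp add: mono3_def)

lemma deriv_add [simp]:
  "deriv_x (p + q) = deriv_x p + deriv_x q" "deriv_y (p + q) = deriv_y p + deriv_y q" "deriv_z (p + q) = deriv_z p + deriv_z q"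
  unfolding deriv_x_def deriv_y_def deriv_z_def by (simp_all add: map_poly_add_hom pderiv_add)

lemma deriv_mono3 [simp]:
  "deriv_x (mono3 c i j k) = mono3 (of_nat i * c) (i - 1) j k"
  "deriv_y (mono3 c i j k) = mono3 (of_nat j * c) i (j - 1) k"
  "deriv_z (mono3 c i j k) = mono3 (of_nat k * c) i j (k - 1)"
  unfolding deriv_x_def deriv_y_def deriv_z_def mono3_def
  by (simp_all add: map_poly_monom pderiv_monom of_nat_poly smult_monom)

lemma total_degreeI:
  assumes "\<And>i j. poly.coeff (poly.coeff f j) i \<noteq> 0 \<Longrightarrow> i + j \<le> n" and "poly.coeff (poly.coeff f j) i \<noteq> 0" "i + j = n"
  shows "total_degree f = n"
  unfolding total_degree_def
proof (rule Max_eqI)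
  show "finite {i + j |i j. poly.coeff (poly.coeff f j) i \<noteq> 0}"
    by (rule finite_subset[of _ "{..n}"]) (use assms(1) in auto)
qed (use assms in auto)

lemma cubic_C_coeffs: "cubic_C = [:[:0, -3, 3:], [:-3, -1, 1:], [:-3:]:]"
  unfolding cubic_C_def var_x_def var_y_def by (simp add: power2_eq_square numeral_poly)

lemma curve_E0_coeffs: "curve_E0 = [:[:-82988928, 384048, 0, -1:], 0, 1:]"
  unfolding curve_E0_def weierstrass_def var_x_def var_y_def by (simp add: power2_eq_square power3_eq_cube numeral_poly one_pCons)

lemma homogenize_cubic_C:
  "homogenize cubic_C = mono3 1 2 1 0 + mono3 3 2 0 1 + mono3 (-1) 1 1 1 + mono3 (-3) 0 2 1 + mono3 (-3) 1 0 2 + mono3 (-3) 0 1 2"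
proof -
  have "total_degree cubic_C = 3"
    by (rule total_degreeI[of _ _ 1 2])
       (auto simp: cubic_C_coeffs coeff_pCons numeral_eq_Suc split: nat.splits)
  then show ?thesis
    unfolding homogenize_def mono3_def[symmetric]
    by (simp add: cubic_C_coeffs numeral_2_eq_2 numeral_3_eq_3)
qed

lemma homogenize_curve_E0:
  "homogenize curve_E0 = mono3 1 0 2 1 + mono3 (-1) 3 0 0 + mono3 384048 1 0 2 + mono3 (-82988928) 0 0 3"
proof -
  have "total_degree curve_E0 = 3"
    by (rule total_degreeI[of _ _ 0 3])
       (auto simp: curve_E0_coeffs coeff_pCons numeral_eq_Suc split: nat.splits)
  then show ?thesis
    unfolding homogenize_def mono3_def[symmetric]
    by (simp add: curve_E0_coeffs numeral_2_eq_2 numeral_3_eq_3)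
qed

lemma eval_cubic_C:
  "eval3 (homogenize cubic_C) x y z = x\<^sup>2 * y + 3 * x\<^sup>2 * z - x * y * z - 3 * y\<^sup>2 * z - 3 * x * z\<^sup>2 - 3 * y * z\<^sup>2"
  "eval3 (deriv_x (homogenize cubic_C)) x y z = 2 * x * y + 6 * x * z - y * z - 3 * z\<^sup>2"
  "eval3 (deriv_y (homogenize cubic_C)) x y z = x\<^sup>2 - x * z - 6 * y * z - 3 * z\<^sup>2"
  "eval3 (deriv_z (homogenize cubic_C)) x y z = 3 * x\<^sup>2 - x * y - 3 * y\<^sup>2 - 6 * x * z - 6 * y * z"
  unfolding homogenize_cubic_C by (simp_all add: of_rat_minus)

lemma eval_curve_E0:
  "eval3 (homogenize curve_E0) x y z = y\<^sup>2 * z - x ^ 3 + 384048 * x * z\<^sup>2 - 82988928 * z ^ 3"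
  "eval3 (deriv_x (homogenize curve_E0)) x y z = - 3 * x\<^sup>2 + 384048 * z\<^sup>2"
  "eval3 (deriv_y (homogenize curve_E0)) x y z = 2 * y * z"
  "eval3 (deriv_z (homogenize curve_E0)) x y z = y\<^sup>2 + 768096 * x * z - 248966784 * z\<^sup>2"
  unfolding homogenize_curve_E0 by (simp_all add: of_rat_minus)

section \<open>The two projective curves\<close>

lemma nonsingular_curve_E0: "nonsingular curve_E0"
  unfolding nonsingular_def eval_curve_E0
proof (intro allI impI)
  fix x y z :: "rat alg_closure"
  assume h: "(x, y, z) \<noteq> (0, 0, 0) \<and> y\<^sup>2 * z - x ^ 3 + 384048 * x * z\<^sup>2 - 82988928 * z ^ 3 = 0"
  show "- 3 * x\<^sup>2 + 384048 * z\<^sup>2 \<noteq> 0 \<or> 2 * y * z \<noteq> 0 \<or> y\<^sup>2 + 768096 * x * z - 248966784 * z\<^sup>2 \<noteq> 0"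
  proof (rule ccontr)
    assume "\<not> ?thesis"
    then have d: "- 3 * x\<^sup>2 + 384048 * z\<^sup>2 = 0" "y = 0 \<or> z = 0" "y\<^sup>2 + 768096 * x * z - 248966784 * z\<^sup>2 = 0"
      by auto
    show False
    proof (cases "z = 0")
      case True
      then show False using d h by simp
    next
      case False
      then have "(768096 * x - 248966784 * z) * z = 0" using d by (simp add: algebra_simps power2_eq_square)
      then have x: "x = 288156 / 889 * z" using False by (simp add: field_simps)
      have "z\<^sup>2 = 0" using d(1) unfolding x by (simp add: power_divide power_mult_distrib field_simps)
      then show False using False by simp
    qed
  qed
qed

text \<open>
  The derivative with respect to \<open>x\<close> factors as \<open>(2 * x - z) * (y + 3 * z)\<close>, so a singular point lies on one of two lines.
\<close>

lemma nonsingular_cubic_C: "nonsingular cubic_C"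
  unfolding nonsingular_def eval_cubic_C
proof (intro allI impI)
  fix x y z :: "rat alg_closure"
  assume h: "(x, y, z) \<noteq> (0, 0, 0) \<and> x\<^sup>2 * y + 3 * x\<^sup>2 * z - x * y * z - 3 * y\<^sup>2 * z - 3 * x * z\<^sup>2 - 3 * y * z\<^sup>2 = 0"
  show "2 * x * y + 6 * x * z - y * z - 3 * z\<^sup>2 \<noteq> 0 \<or> x\<^sup>2 - x * z - 6 * y * z - 3 * z\<^sup>2 \<noteq> 0 \<or>
      3 * x\<^sup>2 - x * y - 3 * y\<^sup>2 - 6 * x * z - 6 * y * z \<noteq> 0"
  proof (rule ccontr)
    assume "\<not> ?thesis"
    then have d: "2 * x * y + 6 * x * z - y * z - 3 * z\<^sup>2 = 0" "x\<^sup>2 - x * z - 6 * y * z - 3 * z\<^sup>2 = 0"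
      "3 * x\<^sup>2 - x * y - 3 * y\<^sup>2 - 6 * x * z - 6 * y * z = 0" by auto
    note c = h[THEN conjunct2]
    have "(2 * x - z) * (y + 3 * z) = 0" using d(1) by (simp add: algebra_simps power2_eq_square)
    then have "z = 2 * x \<or> y = - 3 * z" by (auto simp: eq_neg_iff_add_eq_0)
    then consider "z = 0" | "z \<noteq> 0" "z = 2 * x" | "z \<noteq> 0" "y = - 3 * z" by blast
    then show False
    proof cases
      case 1
      then show False using d h by simp
    next
      case 2
      have "x * (13 * x + 12 * y) = - (x\<^sup>2 - x * z - 6 * y * z - 3 * z\<^sup>2)"
        unfolding 2(2) by (simp add: algebra_simps power2_eq_square)
      then have "x * (13 * x + 12 * y) = 0" using d(2) by simp
      then have "12 * y = - 13 * x" using 2 by (simp add: eq_neg_iff_add_eq_0 add.commute)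
      then have y: "y = - (13 / 12) * x" by (simp add: field_simps)
      have "x ^ 3 = 0" using c unfolding 2(2) y by (simp add: field_simps power2_eq_square power3_eq_cube)
      then show False using 2 by simp
    next
      case 3
      have "z ^ 3 = 0" using c unfolding 3(2) by (simp add: algebra_simps power2_eq_square power3_eq_cube)
      then show False using 3 by simp
    qed
  qed
qed

text \<open>
  Completing the square and the cube in the minimal model leads to the coordinates \<open>12 * (12 * x + 1)\<close> and
  \<open>864 * (2 * y + x + 1)\<close>.
\<close>

lemma weierstrass_iso_E0: "weierstrass_iso curve_E0 cremona_30a2"
  unfolding weierstrass_iso_def
proof (intro exI conjI allI)
  show "(12 :: rat) \<noteq> 0" by simp
  fix x y :: rat
  show "eval2 curve_E0 (12\<^sup>2 * x + 12) (12 ^ 3 * y + 12\<^sup>2 * 6 * x + 864) = 12 ^ 6 * eval2 cremona_30a2 x y"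
    unfolding curve_E0_def cremona_30a2_def weierstrass_def
    by (simp add: of_rat_minus algebra_simps power2_eq_square power3_eq_cube)
qed

lemma proj_pt_scale: "c \<noteq> 0 \<Longrightarrow> proj_pt (c * x) (c * y) (c * z) = proj_pt x y z"
  for c :: "'a::field"
proof -
  assume c: "c \<noteq> 0"
  have "\<exists>d. k * x = d * (c * x) \<and> k * y = d * (c * y) \<and> k * z = d * (c * z) \<and> d \<noteq> 0" if "k \<noteq> 0" for k
    using c that by (intro exI[of _ "k / c"]) simp
  moreover have "\<exists>d. k * (c * x) = d * x \<and> k * (c * y) = d * y \<and> k * (c * z) = d * z \<and> d \<noteq> 0" if "k \<noteq> 0" for k
    using c that by (intro exI[of _ "k * c"]) simp
  ultimately show ?thesis unfolding proj_pt_def by auto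
qed

lemma proj_pt_eqD:
  fixes x :: "'a::field"
  assumes "proj_pt x y z = proj_pt x' y' z'"
  obtains c where "c \<noteq> 0" "x = c * x'" "y = c * y'" "z = c * z'"
proof -
  have "(1 * x, 1 * y, 1 * z) \<in> proj_pt x y z" unfolding proj_pt_def using one_neq_zero by blast
  then have "(x, y, z) \<in> proj_pt x' y' z'" using assms by simp
  then show ?thesis using that unfolding proj_pt_def by auto
qed

lemma aff_pt_inject: "aff_pt a = aff_pt b \<longleftrightarrow> a = b"
proof
  assume "aff_pt a = aff_pt b"
  then have "proj_pt (fst a) (snd a) 1 = proj_pt (fst b) (snd b) 1" by (simp add: aff_pt_def split_beta)
  then show "a = b" by (elim proj_pt_eqD) (simp add: prod_eq_iff)
qed simp

lemma aff_pt_neq_infinite: "aff_pt a \<noteq> proj_pt x y 0"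
proof
  assume "aff_pt a = proj_pt x y 0"
  then have "proj_pt (fst a) (snd a) 1 = proj_pt x y 0" by (simp add: aff_pt_def split_beta)
  then show False by (elim proj_pt_eqD) simp
qed

lemma proj_closure_split:
  fixes f :: "rat poly poly"
  assumes hom: "\<And>c x y z :: 'a::field_char_0. eval3 (homogenize f) (c * x) (c * y) (c * z) = c ^ n * eval3 (homogenize f) x y z"
  shows "proj_closure f = aff_pt ` {(x, y :: 'a). eval3 (homogenize f) x y 1 = 0} \<union>
     {proj_pt x y 0 | x y. (x, y) \<noteq> (0, 0) \<and> eval3 (homogenize f) x y 0 = 0}" (is "_ = ?A \<union> ?B")
proof (intro equalityI subsetI)
  fix P :: "('a \<times> 'a \<times> 'a) set"
  assume "P \<in> proj_closure f"
  then obtain x y z where P: "P = proj_pt x y z" "(x, y, z) \<noteq> (0, 0, 0)" "eval3 (homogenize f) x y z = 0"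
    unfolding proj_closure_def by blast
  show "P \<in> ?A \<union> ?B"
  proof (cases "z = 0")
    case True
    then show ?thesis using P by auto
  next
    case False
    have "proj_pt x y z = proj_pt (inverse z * x) (inverse z * y) (inverse z * z)"
      using proj_pt_scale[of "inverse z" x y z] False by simp
    then have "P = aff_pt (inverse z * x, inverse z * y)" using P False by (simp add: aff_pt_def)
    moreover have "eval3 (homogenize f) (inverse z * x) (inverse z * y) 1 = 0"
      using hom[of "inverse z" x y z] False P by simp
    ultimately show ?thesis by auto
  qed
next
  fix P assume "P \<in> ?A \<union> ?B"
  then obtain x y z where "P = proj_pt x y z" "(x, y, z) \<noteq> (0, 0, 0)" "eval3 (homogenize f) x y z = 0"
    unfolding aff_pt_def by (auto split: prod.splits)
  then show "P \<in> proj_closure f" unfolding proj_closure_def by blast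
qed

lemma proj_closure_cubic_C:
  "proj_closure cubic_C = aff_pt ` {(x, y :: 'a::field_char_0). x\<^sup>2 * y + 3 * x\<^sup>2 - x * y - 3 * y\<^sup>2 - 3 * x - 3 * y = 0} \<union>
     {proj_pt 0 1 0, proj_pt 1 0 0}"
proof -
  have "{proj_pt x y 0 | x y :: 'a. (x, y) \<noteq> (0, 0) \<and> x\<^sup>2 * y = 0} = {proj_pt 0 1 0, proj_pt 1 0 0}" (is "?L = ?R")
  proof (intro equalityI subsetI)
    fix P assume "P \<in> ?L"
    then obtain x y :: 'a where P: "P = proj_pt x y 0" "(x, y) \<noteq> (0, 0)" "x = 0 \<or> y = 0" by auto
    then show "P \<in> ?R" using proj_pt_scale[of y 0 1 0] proj_pt_scale[of x 1 0 0] by auto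
  next
    fix P :: "('a \<times> 'a \<times> 'a) set" assume "P \<in> ?R"
    then consider "P = proj_pt 0 1 0 \<and> (0 :: 'a, 1 :: 'a) \<noteq> (0, 0) \<and> 0\<^sup>2 * (1 :: 'a) = 0" |
      "P = proj_pt 1 0 0 \<and> (1 :: 'a, 0 :: 'a) \<noteq> (0, 0) \<and> 1\<^sup>2 * (0 :: 'a) = 0" by auto
    then show "P \<in> ?L" by cases blast+
  qed
  then show ?thesis
    by (subst proj_closure_split[of _ 3]) (simp_all add: eval_cubic_C algebra_simps power2_eq_square power3_eq_cube)
qed

lemma proj_closure_curve_E0:
  "proj_closure curve_E0 = aff_pt ` {(u, v :: 'a::field_char_0). v\<^sup>2 - u ^ 3 + 384048 * u - 82988928 = 0} \<union>
     {proj_pt 0 1 0}"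
proof -
  have "{proj_pt x y 0 | x y :: 'a. (x, y) \<noteq> (0, 0) \<and> x ^ 3 = 0} = {proj_pt 0 1 0}" (is "?L = ?R")
  proof (intro equalityI subsetI)
    fix P assume "P \<in> ?L"
    then obtain x y :: 'a where P: "P = proj_pt x y 0" "x = 0" "y \<noteq> 0" by auto
    then show "P \<in> ?R" using proj_pt_scale[of y 0 1 0] by simp
  next
    fix P :: "('a \<times> 'a \<times> 'a) set" assume "P \<in> ?R"
    then have "P = proj_pt 0 1 0 \<and> (0 :: 'a, 1 :: 'a) \<noteq> (0, 0) \<and> (0 :: 'a) ^ 3 = 0" by simp
    then show "P \<in> ?L" by blast
  qed
  then show ?thesis
    by (subst proj_closure_split[of _ 3]) (simp_all add: eval_curve_E0 algebra_simps power2_eq_square power3_eq_cube)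
qed

section \<open>The birational map and the rational points\<close>

text \<open>
  In the coordinates \<open>p = (u - 444) / 36\<close>, \<open>q = v / 216\<close> this is \<open>x = 6 * (p + 8) / w\<close>, \<open>y = (q - p - 32) / w\<close>
  with \<open>w = 5 * p + 16 - q\<close>.
\<close>

definition inverse_UV :: rat_map where
  "inverse_UV =
    ((36 * (var_x - 156), 30 * var_x - var_y - 9864),
     (var_y - 6 * var_x - 4248, 30 * var_x - var_y - 9864))"

lemma regular_map_UV: "regular_at map_UV (x, y) \<longleftrightarrow> 2 * x - 3 * y - 3 \<noteq> 0"
  and apply_map_UV: "apply_map map_UV (x, y) =
    ((1176 * x - 468 * y - 468) / (2 * x - 3 * y - 3), 15552 * (x + y - 1) / (2 * x - 3 * y - 3))"
  and regular_inverse_UV: "regular_at inverse_UV (x, y) \<longleftrightarrow> 30 * x - y - 9864 \<noteq> 0"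
  and apply_inverse_UV: "apply_map inverse_UV (x, y) =
    (36 * (x - 156) / (30 * x - y - 9864), (y - 6 * x - 4248) / (30 * x - y - 9864))"
  by (simp_all add: regular_at_def apply_map_def map_UV_def inverse_UV_def)

text \<open>
  The denominators of the two maps are inverse to each other up to the constant 31104. So the inverse map is
  regular at the image without any further condition.
\<close>

lemma map_UV_curve:
  fixes x y :: "'a::field_char_0"
  assumes C: "x\<^sup>2 * y + 3 * x\<^sup>2 - x * y - 3 * y\<^sup>2 - 3 * x - 3 * y = 0" and D: "2 * x - 3 * y - 3 \<noteq> 0"
    and uv: "(u, v) = apply_map map_UV (x, y)"
  shows "v\<^sup>2 - u ^ 3 + 384048 * u - 82988928 = 0" "30 * u - v - 9864 \<noteq> 0" "apply_map inverse_UV (u, v) = (x, y)"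
proof -
  define d n m where dnm: "d = 2 * x - 3 * y - 3" "n = 1176 * x - 468 * y - 468" "m = 15552 * (x + y - 1)"
  have u: "u = n / d" "v = m / d" using uv unfolding apply_map_UV dnm by simp_all
  have d: "d \<noteq> 0" using D dnm by simp
  have "m\<^sup>2 * d - n ^ 3 + 384048 * n * d\<^sup>2 - 82988928 * d ^ 3 =
      -967458816 * (x\<^sup>2 * y + 3 * x\<^sup>2 - x * y - 3 * y\<^sup>2 - 3 * x - 3 * y)"
    unfolding dnm by (simp add: algebra_simps power2_eq_square power3_eq_cube)
  then have "m\<^sup>2 * d - n ^ 3 + 384048 * n * d\<^sup>2 - 82988928 * d ^ 3 = 0" unfolding C by simp
  moreover have "(v\<^sup>2 - u ^ 3 + 384048 * u - 82988928) * d ^ 3 = m\<^sup>2 * d - n ^ 3 + 384048 * n * d\<^sup>2 - 82988928 * d ^ 3"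
    unfolding u using d by (simp add: field_simps power2_eq_square power3_eq_cube)
  ultimately show "v\<^sup>2 - u ^ 3 + 384048 * u - 82988928 = 0" using d by simp
  have "(30 * u - v - 9864) * d = 30 * n - m - 9864 * d" unfolding u using d by (simp add: algebra_simps)
  also have "\<dots> = 31104" unfolding dnm by (simp add: algebra_simps)
  finally have w: "30 * u - v - 9864 = 31104 / d" using d by (simp add: field_simps)
  then show "30 * u - v - 9864 \<noteq> 0" using d by simp
  have "36 * (u - 156) * d = 31104 * x" "(v - 6 * u - 4248) * d = 31104 * y"
  proof -
    have "36 * (u - 156) * d = 36 * (n - 156 * d)" "(v - 6 * u - 4248) * d = m - 6 * n - 4248 * d"
      unfolding u using d by (simp_all add: algebra_simps)
    then show "36 * (u - 156) * d = 31104 * x" "(v - 6 * u - 4248) * d = 31104 * y"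
      unfolding dnm by (simp_all add: algebra_simps)
  qed
  then show "apply_map inverse_UV (u, v) = (x, y)"
    unfolding apply_inverse_UV w using d by (simp add: field_simps)
qed

lemma inverse_UV_curve:
  fixes u v :: "'a::field_char_0"
  assumes E: "v\<^sup>2 - u ^ 3 + 384048 * u - 82988928 = 0" and W: "30 * u - v - 9864 \<noteq> 0"
    and xy: "(x, y) = apply_map inverse_UV (u, v)"
  shows "x\<^sup>2 * y + 3 * x\<^sup>2 - x * y - 3 * y\<^sup>2 - 3 * x - 3 * y = 0" "2 * x - 3 * y - 3 \<noteq> 0" "apply_map map_UV (x, y) = (u, v)"
proof -
  define w n m where wnm: "w = 30 * u - v - 9864" "n = 36 * (u - 156)" "m = v - 6 * u - 4248"
  have x: "x = n / w" "y = m / w" using xy unfolding apply_inverse_UV wnm by simp_all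
  have w: "w \<noteq> 0" using W wnm by simp
  have "n\<^sup>2 * m + 3 * n\<^sup>2 * w - n * m * w - 3 * m\<^sup>2 * w - 3 * n * w\<^sup>2 - 3 * m * w\<^sup>2 =
      -31104 * (v\<^sup>2 - u ^ 3 + 384048 * u - 82988928)"
    unfolding wnm by (simp add: algebra_simps power2_eq_square power3_eq_cube)
  then have "n\<^sup>2 * m + 3 * n\<^sup>2 * w - n * m * w - 3 * m\<^sup>2 * w - 3 * n * w\<^sup>2 - 3 * m * w\<^sup>2 = 0" unfolding E by simp
  moreover have "(x\<^sup>2 * y + 3 * x\<^sup>2 - x * y - 3 * y\<^sup>2 - 3 * x - 3 * y) * w ^ 3 =
      n\<^sup>2 * m + 3 * n\<^sup>2 * w - n * m * w - 3 * m\<^sup>2 * w - 3 * n * w\<^sup>2 - 3 * m * w\<^sup>2"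
    unfolding x using w by (simp add: field_simps power2_eq_square power3_eq_cube)
  ultimately show "x\<^sup>2 * y + 3 * x\<^sup>2 - x * y - 3 * y\<^sup>2 - 3 * x - 3 * y = 0" using w by simp
  have "(2 * x - 3 * y - 3) * w = 2 * n - 3 * m - 3 * w" unfolding x using w by (simp add: algebra_simps)
  also have "\<dots> = 31104" unfolding wnm by (simp add: algebra_simps)
  finally have d: "2 * x - 3 * y - 3 = 31104 / w" using w by (simp add: field_simps)
  then show "2 * x - 3 * y - 3 \<noteq> 0" using w by simp
  have "(1176 * x - 468 * y - 468) * w = 31104 * u" "15552 * (x + y - 1) * w = 31104 * v"
  proof -
    have "(1176 * x - 468 * y - 468) * w = 1176 * n - 468 * m - 468 * w" "15552 * (x + y - 1) * w = 15552 * (n + m - w)"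
      unfolding x using w by (simp_all add: algebra_simps)
    then show "(1176 * x - 468 * y - 468) * w = 31104 * u" "15552 * (x + y - 1) * w = 31104 * v"
      unfolding wnm by (simp_all add: algebra_simps)
  qed
  then show "apply_map map_UV (x, y) = (u, v)"
    unfolding apply_map_UV d using w by (simp add: field_simps)
qed

text \<open>
  On the tangent \<open>2 * x - 3 * y - 3 = 0\<close> the cubic restricts to \<open>2/3 * x ^ 3\<close>.
\<close>

lemma cubic_C_flex:
  fixes x y :: "'a::field_char_0"
  assumes C: "x\<^sup>2 * y + 3 * x\<^sup>2 - x * y - 3 * y\<^sup>2 - 3 * x - 3 * y = 0" and D: "2 * x - 3 * y - 3 = 0"
  shows "x = 0 \<and> y = -1"
proof -
  have y: "y = (2 * x - 3) / 3" using D by (simp add: field_simps)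
  have "x ^ 3 = 3 / 2 * (x\<^sup>2 * y + 3 * x\<^sup>2 - x * y - 3 * y\<^sup>2 - 3 * x - 3 * y)"
    unfolding y by (simp add: field_simps power2_eq_square power3_eq_cube)
  then have "x ^ 3 = 0" unfolding C by simp
  then show ?thesis using y by simp
qed

text \<open>
  In the coordinates \<open>p\<close>, \<open>q\<close> the line is \<open>q = 5 * p + 16\<close>; it passes through the point with \<open>p = 4\<close> and is tangent in the
  one with \<open>p = -8\<close>. These points correspond to the points at infinity of \<open>C\<close>.
\<close>

lemma curve_E0_base_points:
  fixes u v :: "'a::field_char_0"
  assumes E: "v\<^sup>2 - u ^ 3 + 384048 * u - 82988928 = 0" and W: "30 * u - v - 9864 = 0"
  shows "(u, v) \<in> {(588, 7776), (156, -5184)}"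
proof -
  have v: "v = 30 * u - 9864" using W by (simp add: algebra_simps)
  have "(u - 588) * (u - 156)\<^sup>2 = - (v\<^sup>2 - u ^ 3 + 384048 * u - 82988928)"
    unfolding v by (simp add: algebra_simps power2_eq_square power3_eq_cube)
  then have "u = 588 \<or> u = 156" unfolding E by auto
  then show ?thesis unfolding v by auto
qed

lemma finite_exceptions:
  assumes "proj_closure f = aff_pt ` A \<union> B" "finite B" "finite {a \<in> A. \<not> Q a}"
  shows "finite {P \<in> proj_closure f. \<not> (\<exists>a. P = aff_pt a \<and> Q a)}"
proof (rule finite_subset)
  show "{P \<in> proj_closure f. \<not> (\<exists>a. P = aff_pt a \<and> Q a)} \<subseteq> aff_pt ` {a \<in> A. \<not> Q a} \<union> B"
    using assms(1) by auto
qed (use assms in simp)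

lemma aff_pt_closure_iff:
  "aff_pt (x, y) \<in> proj_closure cubic_C \<longleftrightarrow> x\<^sup>2 * y + 3 * x\<^sup>2 - x * y - 3 * y\<^sup>2 - 3 * x - 3 * y = 0"
  "aff_pt (u, v) \<in> proj_closure curve_E0 \<longleftrightarrow> v\<^sup>2 - u ^ 3 + 384048 * u - 82988928 = 0"
  unfolding proj_closure_cubic_C proj_closure_curve_E0
  by (auto simp: aff_pt_inject aff_pt_neq_infinite image_iff)

lemma birational_map_UV: "birational_via map_UV cubic_C curve_E0"
proof -
  let ?A = "{(x, y :: rat alg_closure). x\<^sup>2 * y + 3 * x\<^sup>2 - x * y - 3 * y\<^sup>2 - 3 * x - 3 * y = 0}"
  let ?B = "{(u, v :: rat alg_closure). v\<^sup>2 - u ^ 3 + 384048 * u - 82988928 = 0}"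
  have "{a \<in> ?A. \<not> regular_at map_UV a} \<subseteq> {(0, -1)}"
  proof
    fix a assume a: "a \<in> {a \<in> ?A. \<not> regular_at map_UV a}"
    obtain x y where "a = (x, y)" by (cases a)
    then show "a \<in> {(0, -1)}" using a cubic_C_flex[of x y] by (simp add: regular_map_UV)
  qed
  then have "finite {a \<in> ?A. \<not> regular_at map_UV a}" by (rule finite_subset) simp
  then have f1: "finite {P \<in> proj_closure cubic_C. \<not> (\<exists>a :: rat alg_closure \<times> _. P = aff_pt a \<and> regular_at map_UV a)}"
    by (intro finite_exceptions[OF proj_closure_cubic_C]) simp_all
  have "{a \<in> ?B. \<not> regular_at inverse_UV a} \<subseteq> {(588, 7776), (156, -5184)}"
  proof
    fix a assume a: "a \<in> {a \<in> ?B. \<not> regular_at inverse_UV a}"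
    obtain u v where "a = (u, v)" by (cases a)
    then show "a \<in> {(588, 7776), (156, -5184)}" using a curve_E0_base_points[of v u] by (simp add: regular_inverse_UV)
  qed
  then have "finite {a \<in> ?B. \<not> regular_at inverse_UV a}" by (rule finite_subset) simp
  then have f2: "finite {P \<in> proj_closure curve_E0. \<not> (\<exists>a :: rat alg_closure \<times> _. P = aff_pt a \<and> regular_at inverse_UV a)}"
    by (intro finite_exceptions[OF proj_closure_curve_E0]) simp_all
  have r1: "rational_map_between map_UV cubic_C curve_E0"
    unfolding rational_map_between_def
  proof (intro conjI allI impI f1)
    fix a :: "rat alg_closure \<times> rat alg_closure"
    assume a: "aff_pt a \<in> proj_closure cubic_C \<and> regular_at map_UV a"
    obtain x y u v where xy: "a = (x, y)" "apply_map map_UV a = (u, v)" by (metis surj_pair)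
    show "aff_pt (apply_map map_UV a) \<in> proj_closure curve_E0"
      unfolding xy(2) aff_pt_closure_iff
      by (rule map_UV_curve(1)[of x y]) (use a xy in \<open>simp_all only: aff_pt_closure_iff regular_map_UV simp_thms\<close>)
  qed
  have r2: "rational_map_between inverse_UV curve_E0 cubic_C"
    unfolding rational_map_between_def
  proof (intro conjI allI impI f2)
    fix a :: "rat alg_closure \<times> rat alg_closure"
    assume a: "aff_pt a \<in> proj_closure curve_E0 \<and> regular_at inverse_UV a"
    obtain x y u v where uv: "a = (u, v)" "apply_map inverse_UV a = (x, y)" by (metis surj_pair)
    show "aff_pt (apply_map inverse_UV a) \<in> proj_closure cubic_C"
      unfolding uv(2) aff_pt_closure_iff
      by (rule inverse_UV_curve(1)[of v u]) (use a uv in \<open>simp_all only: aff_pt_closure_iff regular_inverse_UV simp_thms\<close>)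
  qed
  have c1: "comp_is_identity inverse_UV map_UV cubic_C"
    unfolding comp_is_identity_def
  proof (rule finite_subset[OF _ f1], clarify)
    fix a :: "rat alg_closure \<times> rat alg_closure"
    assume a: "aff_pt a \<in> proj_closure cubic_C" "regular_at map_UV a"
      and n: "\<not> (\<exists>b. aff_pt a = aff_pt b \<and> regular_at map_UV b \<and> regular_at inverse_UV (apply_map map_UV b) \<and>
          apply_map inverse_UV (apply_map map_UV b) = b)"
    obtain x y u v where xy: "a = (x, y)" "apply_map map_UV a = (u, v)" by (metis surj_pair)
    have "regular_at inverse_UV (u, v)" "apply_map inverse_UV (u, v) = (x, y)"
      unfolding regular_inverse_UV using a xy
      by (intro map_UV_curve(2,3)[of x y u v]; simp only: aff_pt_closure_iff regular_map_UV simp_thms)+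
    then have "regular_at inverse_UV (apply_map map_UV a) \<and> apply_map inverse_UV (apply_map map_UV a) = a"
      using xy by simp
    then show False using n a(2) by blast
  qed
  have c2: "comp_is_identity map_UV inverse_UV curve_E0"
    unfolding comp_is_identity_def
  proof (rule finite_subset[OF _ f2], clarify)
    fix a :: "rat alg_closure \<times> rat alg_closure"
    assume a: "aff_pt a \<in> proj_closure curve_E0" "regular_at inverse_UV a"
      and n: "\<not> (\<exists>b. aff_pt a = aff_pt b \<and> regular_at inverse_UV b \<and> regular_at map_UV (apply_map inverse_UV b) \<and>
          apply_map map_UV (apply_map inverse_UV b) = b)"
    obtain x y u v where uv: "a = (u, v)" "apply_map inverse_UV a = (x, y)" by (metis surj_pair)
    have "regular_at map_UV (x, y)" "apply_map map_UV (x, y) = (u, v)"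
      unfolding regular_map_UV using a uv
      by (intro inverse_UV_curve(2,3)[of v u x y]; simp only: aff_pt_closure_iff regular_inverse_UV simp_thms)+
    then have "regular_at map_UV (apply_map inverse_UV a) \<and> apply_map map_UV (apply_map inverse_UV a) = a"
      using uv by simp
    then show False using n a(2) by blast
  qed
  show ?thesis unfolding birational_via_def using r1 r2 c1 c2 by blast
qed

text \<open>
  Once the abscissa \<open>p\<close> on the split cubic is known, so is \<open>q\<close> up to sign, then \<open>d\<close> from
  \<open>(5 * p + 16 - q) * d = 144\<close>, and then the point.
\<close>

lemma rational_affine_points:
  fixes x y :: rat
  shows "x\<^sup>2 * y + 3 * x\<^sup>2 - x * y - 3 * y\<^sup>2 - 3 * x - 3 * y = 0 \<longleftrightarrow>
    (x, y) \<in> {(1, 0), (3, 3), (1/2, -1/3), (0, 0), (-2, 3), (3, -2), (1, -1), (1/2, -3/4), (-2, -2), (0, -1)}"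
proof
  assume C: "x\<^sup>2 * y + 3 * x\<^sup>2 - x * y - 3 * y\<^sup>2 - 3 * x - 3 * y = 0"
  show "(x, y) \<in> {(1, 0), (3, 3), (1/2, -1/3), (0, 0), (-2, 3), (3, -2), (1, -1), (1/2, -3/4), (-2, -2), (0, -1)}"
  proof (cases "2 * x - 3 * y - 3 = 0")
    case True
    then show ?thesis using cubic_C_flex[OF C] by simp
  next
    case False
    define d n m where dnm: "d = 2 * x - 3 * y - 3" "n = x + 3 * y + 3" "m = x + y - 1"
    define p q where pq: "p = 8 * n / d" "q = 72 * m / d"
    have d: "d \<noteq> 0" using False dnm by simp
    have "8 * n * (8 * n + 5 * d) * (8 * n + 32 * d) - 5184 * m\<^sup>2 * d =
        20736 * (x\<^sup>2 * y + 3 * x\<^sup>2 - x * y - 3 * y\<^sup>2 - 3 * x - 3 * y)"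
      unfolding dnm by (simp add: algebra_simps power2_eq_square power3_eq_cube)
    then have z: "8 * n * (8 * n + 5 * d) * (8 * n + 32 * d) = 5184 * m\<^sup>2 * d" unfolding C by simp
    have "p * (p + 5) * (p + 32) = 8 * n * (8 * n + 5 * d) * (8 * n + 32 * d) / d ^ 3"
    proof -
      have "p + 5 = (8 * n + 5 * d) / d" "p + 32 = (8 * n + 32 * d) / d"
        unfolding pq using d by (simp_all add: add_divide_distrib)
      then show ?thesis unfolding pq(1) by (simp only: times_divide_times_eq power3_eq_cube)
    qed
    also have "\<dots> = q\<^sup>2"
      unfolding z pq using d by (simp add: power_divide power_mult_distrib power2_eq_square power3_eq_cube)
    finally have eq: "p * (p + 5) * (p + 32) = q\<^sup>2" .
    have "(5 * p + 16 - q) * d = 40 * n + 16 * d - 72 * m" unfolding pq using d by (simp add: algebra_simps)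
    also have "\<dots> = 144" unfolding dnm by (simp add: algebra_simps)
    finally have W: "(5 * p + 16 - q) * d = 144" .
    have "(p + 8) * d = 8 * n + 8 * d" unfolding pq using d by (simp add: algebra_simps)
    also have "\<dots> = 24 * x" unfolding dnm by (simp add: algebra_simps)
    finally have x: "x = (p + 8) * d / 24" by simp
    have y: "y = (2 * x - 3 - d) / 3" unfolding dnm by simp
    have root: "q = r \<or> q = - r" if "q\<^sup>2 = r\<^sup>2" for r using that by (simp add: power2_eq_iff)
    have "p \<in> {0, -5, -32, 4, 40, -8, -20}" by (rule split_cubic_points[OF eq])
    then consider "p = 0" "q = 0" | "p = -5" "q = 0" | "p = -32" "q = 0" | "p = 4" "q = 36 \<or> q = -36" |
      "p = 40" "q = 360 \<or> q = - 360" | "p = -8" "q = 24 \<or> q = -24" | "p = -20" "q = 60 \<or> q = -60"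
      using eq root[of 36] root[of 360] root[of 24] root[of 60] by auto
    then show ?thesis
    proof cases
      case 1
      then have "d = 9" using W by simp
      then show ?thesis using x y 1 by simp
    next
      case 2
      then have "d = -16" using W by simp
      then show ?thesis using x y 2 by simp
    next
      case 3
      then have "d = -1" using W by simp
      then show ?thesis using x y 3 by simp
    next
      case 4
      then have "d = 2" using W by auto
      then show ?thesis using x y 4 by simp
    next
      case 5
      then have "d = -1 \<or> d = 1/4" using W by auto
      then show ?thesis unfolding y x 5(1) by (elim disjE) simp_all
    next
      case 6
      then have "d = -3" using W by auto
      then show ?thesis using x y 6 by simp
    next
      case 7
      then have "d = -1 \<or> d = -6" using W by auto
      then show ?thesis unfolding y x 7(1) by (elim disjE) simp_all
    qed
  qed
next
  assume "(x, y) \<in> {(1, 0), (3, 3), (1/2, -1/3), (0, 0), (-2, 3), (3, -2), (1, -1), (1/2, -3/4), (-2, -2), (0, -1)}"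
  then show "x\<^sup>2 * y + 3 * x\<^sup>2 - x * y - 3 * y\<^sup>2 - 3 * x - 3 * y = 0"
    unfolding insert_iff empty_iff prod.inject
    by (elim disjE conjE FalseE; hypsubst; simp add: power2_eq_square)
qed

lemma rational_points_cubic_C:
  "(proj_closure cubic_C :: (rat \<times> rat \<times> rat) set set) =
    aff_pt ` {(1, 0), (3, 3), (1/2, -1/3), (0, 0), (-2, 3), (3, -2), (1, -1), (1/2, -3/4), (-2, -2), (0, -1)}
    \<union> {proj_pt 0 1 0, proj_pt 1 0 0}"
proof -
  have "{(x, y). (x, y) \<in> A} = A" for A :: "(rat \<times> rat) set" by auto
  then show ?thesis unfolding proj_closure_cubic_C rational_affine_points by (simp only:)
qed

lemma card_rational_points_cubic_C: "card (proj_closure cubic_C :: (rat \<times> rat \<times> rat) set set) = 12"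
proof -
  let ?A = "{(1, 0), (3, 3), (1/2, -1/3), (0, 0), (-2, 3), (3, -2), (1, -1), (1/2, -3/4), (-2, -2), (0, -1)} :: (rat \<times> rat) set"
  have "card (aff_pt ` ?A) = card ?A" by (intro card_image inj_onI) (simp only: aff_pt_inject)
  moreover have "card ?A = 10" by simp
  moreover have "proj_pt (0::rat) 1 0 \<noteq> proj_pt 1 0 0" using proj_pt_eqD[of "0::rat" 1 0 1 0 0] by force
  then have "card {proj_pt (0::rat) 1 0, proj_pt 1 0 0} = 2" by simp
  moreover have "aff_pt ` ?A \<inter> {proj_pt 0 1 0, proj_pt 1 0 0} = {}"
    using aff_pt_neq_infinite by (metis (no_types, lifting) Int_emptyI imageE insertE singletonD)
  ultimately show ?thesis unfolding rational_points_cubic_C by (subst card_Un_disjoint) simp_all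
qed

section \<open>Action of the alternating group on integer triples\<close>

type_synonym triple = "int \<times> int \<times> int"

definition vec3 :: "triple \<Rightarrow> real ^ 3" where
  "vec3 = (\<lambda>(a, b, c). vector [of_int a, of_int b, of_int c])"

lemma vec3_inject [simp]: "vec3 s = vec3 t \<longleftrightarrow> s = t"
  by (cases s; cases t) (auto simp: vec3_def vec_eq_iff forall_3)

definition turn1 :: "triple \<Rightarrow> triple" where "turn1 = (\<lambda>(a, b, c). (b, -c, -a))"
definition turn2 :: "triple \<Rightarrow> triple" where "turn2 = (\<lambda>(a, b, c). (a, -b, -c))"
definition turn3 :: "triple \<Rightarrow> triple" where "turn3 = (\<lambda>(a, b, c). (-a, b, -c))"

lemma real_mat_mult: "real_mat (A ** B) = real_mat A ** real_mat B"
  by (simp add: real_mat_def matrix_matrix_mult_def)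

lemma real_mat_add: "real_mat (A + B) = real_mat A + real_mat B"
  by (simp add: real_mat_def vec_eq_iff)

text \<open>
  The matrices are signed permutation matrices. Recording their effect on integer triples reduces the
  geometry of the twelve nodes to evaluation of functions on integers.
\<close>

definition acts_as :: "((nat \<Rightarrow> nat) \<Rightarrow> int ^ 3 ^ 3) \<Rightarrow> (nat \<Rightarrow> nat) \<Rightarrow> (triple \<Rightarrow> triple) \<Rightarrow> bool" where
  "acts_as \<rho> g r \<longleftrightarrow> g \<in> carrier (alt_group 4) \<and> (\<forall>t. real_mat (\<rho> g) *v vec3 t = vec3 (r t))"

lemma acts_as_comp:
  assumes "is_rho \<rho>" "acts_as \<rho> g r" "acts_as \<rho> h s"
  shows "acts_as \<rho> (g \<circ> h) (r \<circ> s)"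
proof -
  have "g \<circ> h \<in> carrier (alt_group 4)"
    using assms group.is_monoid[OF alt_group_is_group] monoid.m_closed
    unfolding acts_as_def by (metis alt_group_mult)
  moreover have "\<rho> (g \<circ> h) = \<rho> g ** \<rho> h"
    using assms unfolding acts_as_def is_rho_def hom_def by (auto simp: alt_group_mult GL_def)
  ultimately show ?thesis
    using assms unfolding acts_as_def by (simp add: real_mat_mult del: split_paired_All flip: matrix_vector_mul_assoc)
qed

lemma generators_eq:
  "g1 = Transposition.transpose 1 2 \<circ> Transposition.transpose 2 3" "g2 = Transposition.transpose 1 2 \<circ> Transposition.transpose 3 4"
  "g3 = Transposition.transpose 1 3 \<circ> Transposition.transpose 2 4" "c1 = g1 \<circ> g2" "c2 = g1 \<circ> g3"
  unfolding g1_def g2_def g3_def c1_def c2_def by (auto simp: fun_eq_iff Transposition.transpose_def)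

lemma generators_carrier: "g1 \<in> carrier (alt_group 4)" "g2 \<in> carrier (alt_group 4)" "g3 \<in> carrier (alt_group 4)"
  unfolding alt_group_carrier generators_eq
  by (auto intro!: permutes_compose permutes_swap_id simp: evenperm_comp evenperm_swap permutation_swap_id)

lemma generators_act:
  assumes "is_rho \<rho>"
  shows "acts_as \<rho> g1 turn1" "acts_as \<rho> g2 turn2" "acts_as \<rho> g3 turn3"
  using assms generators_carrier unfolding acts_as_def is_rho_def
  by (auto simp: real_mat_def vec3_def turn1_def turn2_def turn3_def vec_eq_iff forall_3 matrix_vector_mult_def sum_3)

lemma id_acts:
  assumes "is_rho \<rho>" shows "acts_as \<rho> id id"
proof -
  have "g2 \<circ> g2 = id" unfolding generators_eq by (auto simp: fun_eq_iff Transposition.transpose_def)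
  moreover have "turn2 \<circ> turn2 = id" by (auto simp: turn2_def)
  ultimately show ?thesis using acts_as_comp[OF assms generators_act(2) generators_act(2)] assms by metis
qed

definition rotations :: "(triple \<Rightarrow> triple) list" where
  "rotations = [id, turn1, turn1 \<circ> turn1, turn2, turn2 \<circ> turn1, turn2 \<circ> (turn1 \<circ> turn1),
    turn3, turn3 \<circ> turn1, turn3 \<circ> (turn1 \<circ> turn1),
    turn2 \<circ> turn3, (turn2 \<circ> turn3) \<circ> turn1, (turn2 \<circ> turn3) \<circ> (turn1 \<circ> turn1)]"

definition words :: "(nat \<Rightarrow> nat) list" where
  "words = [id, g1, g1 \<circ> g1, g2, g2 \<circ> g1, g2 \<circ> (g1 \<circ> g1), g3, g3 \<circ> g1, g3 \<circ> (g1 \<circ> g1),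
    g2 \<circ> g3, (g2 \<circ> g3) \<circ> g1, (g2 \<circ> g3) \<circ> (g1 \<circ> g1)]"

lemma words_act:
  assumes "is_rho \<rho>" shows "list_all2 (acts_as \<rho>) words rotations"
  unfolding words_def rotations_def
  by (simp only: list_all2_Cons list_all2_Nil simp_thms)
    (intro conjI id_acts acts_as_comp generators_act assms)

text \<open>
  The words are pairwise different because the rotations that they act by move \<open>(1, 2, 3)\<close> to different
  places, and the group has twelve elements.
\<close>

lemma alt_group_words:
  assumes "is_rho \<rho>" shows "carrier (alt_group 4) = set words"
proof -
  have len: "length words = 12" "length rotations = 12" by (simp_all add: words_def rotations_def)
  have act: "acts_as \<rho> (words ! i) (rotations ! i)" if "i < 12" for i
    using words_act[OF assms] that len by (simp add: list_all2_conv_all_nth)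
  have d: "distinct (map (\<lambda>r. r (1, 2, 3)) rotations)"
    by (simp add: rotations_def turn1_def turn2_def turn3_def)
  have "distinct words"
    unfolding distinct_conv_nth len
  proof (intro allI impI notI)
    fix i j :: nat assume ij: "i < 12" "j < 12" "i \<noteq> j" "words ! i = words ! j"
    then have "vec3 ((rotations ! i) (1, 2, 3)) = vec3 ((rotations ! j) (1, 2, 3))"
      using act[of i] act[of j] unfolding acts_as_def by metis
    then show False using d ij len by (simp add: distinct_conv_nth)
  qed
  then have "card (set words) = 12" using len by (simp add: distinct_card)
  moreover have "set words \<subseteq> carrier (alt_group 4)"
    using act len unfolding acts_as_def by (auto simp: in_set_conv_nth)
  moreover have "card (carrier (alt_group 4)) = 12"
    using alt_group_card_carrier[of 4] by (simp add: fact_numeral)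
  ultimately show ?thesis by (metis card_subset_eq card.infinite zero_neq_numeral)
qed

lemma all_words:
  assumes "is_rho \<rho>"
  shows "g \<in> carrier (alt_group 4) \<Longrightarrow> \<exists>r\<in>set rotations. acts_as \<rho> g r"
    and "r \<in> set rotations \<Longrightarrow> \<exists>g. acts_as \<rho> g r"
  using words_act[OF assms] unfolding alt_group_words[OF assms] list_all2_conv_all_nth
  by (metis in_set_conv_nth)+

text \<open>
  The scale \<open>5/3\<close> is the size of the nodes at the parameter \<open>(1/2, -1/3)\<close>.
\<close>

definition pt :: "triple \<Rightarrow> real ^ 3" where "pt t = (5 / 3) *\<^sub>R vec3 t"

lemma pt_inject [simp]: "pt s = pt t \<longleftrightarrow> s = t"
  by (simp add: pt_def)

lemma p0_half: "p0 (1 / 2) (- 1 / 3) = pt (0, 1, 1)"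
  by (simp add: p0_def pt_def vec3_def vec_eq_iff forall_3 power2_eq_square)

lemma acts_pt: "acts_as \<rho> g r \<Longrightarrow> real_mat (\<rho> g) *v pt t = pt (r t)"
  unfolding acts_as_def pt_def by (simp add: matrix_vector_mult_scaleR del: split_paired_All)

lemma acts_node: "acts_as \<rho> g r \<Longrightarrow> node \<rho> (1 / 2) (- 1 / 3) g = pt (r (0, 1, 1))"
  unfolding node_def p0_half using acts_pt[of \<rho> g r "(0, 1, 1)"] by simp

definition vertices :: "triple list" where
  "vertices = [(0,1,1), (0,1,-1), (0,-1,1), (0,-1,-1), (1,0,1), (1,0,-1), (-1,0,1), (-1,0,-1),
    (1,1,0), (1,-1,0), (-1,1,0), (-1,-1,0)]"

text \<open>
  If \<open>g\<close> acts as \<open>r\<close>, the nodes of \<open>g\<close>, \<open>g \<circ> c1\<close>, \<open>g \<circ> c2\<close> are the multiples by \<open>5/3\<close> of these values of \<open>r\<close>.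
\<close>

definition arcs :: "(triple \<times> triple) list" where
  "arcs = concat (map (\<lambda>r. [(r (0,1,1), r (-1,1,0)), (r (0,1,1), r (1,1,0))]) rotations)"

definition dot :: "triple \<Rightarrow> triple \<Rightarrow> int" where
  "dot = (\<lambda>(a, b, c) (x, y, z). a * x + b * y + c * z)"

lemma set_vertices: "(\<lambda>r. r (0, 1, 1)) ` set rotations = set vertices"
  by (auto simp: rotations_def vertices_def turn1_def turn2_def turn3_def)

lemma nodes_half:
  assumes "is_rho \<rho>" shows "nodes \<rho> (1 / 2) (- 1 / 3) = pt ` set vertices"
proof -
  have "nodes \<rho> (1 / 2) (- 1 / 3) = (\<lambda>r. pt (r (0, 1, 1))) ` set rotations"
    unfolding nodes_def
  proof (intro equalityI subsetI)
    fix v assume "v \<in> node \<rho> (1 / 2) (- 1 / 3) ` carrier (alt_group 4)"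
    then obtain g where g: "g \<in> carrier (alt_group 4)" "v = node \<rho> (1 / 2) (- 1 / 3) g" by blast
    obtain r where r: "r \<in> set rotations" "acts_as \<rho> g r" using all_words(1)[OF assms g(1)] by blast
    show "v \<in> (\<lambda>r. pt (r (0, 1, 1))) ` set rotations"
      unfolding g(2) acts_node[OF r(2)] using r(1) by (rule imageI)
  next
    fix v assume "v \<in> (\<lambda>r. pt (r (0, 1, 1))) ` set rotations"
    then obtain r where r: "r \<in> set rotations" "v = pt (r (0, 1, 1))" by blast
    then obtain g where g: "acts_as \<rho> g r" using all_words(2)[OF assms] by blast
    then show "v \<in> node \<rho> (1 / 2) (- 1 / 3) ` carrier (alt_group 4)"
      unfolding r(2) acts_node[OF g, symmetric] using g unfolding acts_as_def by blast
  qed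
  then show ?thesis unfolding set_vertices[symmetric] by (simp add: image_image)
qed

lemma cables_half:
  assumes "is_rho \<rho>"
  shows "cables \<rho> (1 / 2) (- 1 / 3) = {closed_segment (pt s) (pt t) | s t. (s, t) \<in> set arcs}"
proof -
  have c: "acts_as \<rho> c1 (turn1 \<circ> turn2)" "acts_as \<rho> c2 (turn1 \<circ> turn3)"
    unfolding generators_eq(4,5) by (intro acts_as_comp generators_act assms)+
  have c': "c1 \<in> carrier (alt_group 4)" "c2 \<in> carrier (alt_group 4)" using c unfolding acts_as_def by auto
  have img: "(turn1 \<circ> turn2) (0, 1, 1) = (-1, 1, 0)" "(turn1 \<circ> turn3) (0, 1, 1) = (1, 1, 0)"
    by (simp_all add: turn1_def turn2_def turn3_def)
  have n: "node \<rho> (1 / 2) (- 1 / 3) (g \<circ> c1) = pt (r (-1, 1, 0))"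
      "node \<rho> (1 / 2) (- 1 / 3) (g \<circ> c2) = pt (r (1, 1, 0))" if "acts_as \<rho> g r" for g r
    using acts_node[OF acts_as_comp[OF assms that c(1)]] acts_node[OF acts_as_comp[OF assms that c(2)]] img by simp_all
  have arcs: "(s, t) \<in> set arcs \<longleftrightarrow> (\<exists>r\<in>set rotations. s = r (0,1,1) \<and> (t = r (-1,1,0) \<or> t = r (1,1,0)))" for s t
    unfolding arcs_def by auto
  show ?thesis
  proof (intro equalityI subsetI)
    fix e assume "e \<in> cables \<rho> (1 / 2) (- 1 / 3)"
    then obtain g h where g: "g \<in> carrier (alt_group 4)" "h = g \<circ> c1 \<or> h = g \<circ> c2"
      "e = closed_segment (node \<rho> (1 / 2) (- 1 / 3) g) (node \<rho> (1 / 2) (- 1 / 3) h)"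
      unfolding cables_def alt_group_mult by blast
    obtain r where r: "r \<in> set rotations" "acts_as \<rho> g r" using all_words(1)[OF assms g(1)] by blast
    have "e = closed_segment (pt (r (0,1,1))) (pt (r (-1,1,0))) \<or> e = closed_segment (pt (r (0,1,1))) (pt (r (1,1,0)))"
      using g(2,3) n[OF r(2)] acts_node[OF r(2)] by auto
    then show "e \<in> {closed_segment (pt s) (pt t) | s t. (s, t) \<in> set arcs}"
      using arcs r(1) by blast
  next
    fix e assume "e \<in> {closed_segment (pt s) (pt t) | s t. (s, t) \<in> set arcs}"
    then obtain s t where st: "(s, t) \<in> set arcs" "e = closed_segment (pt s) (pt t)" by blast
    obtain r where "r \<in> set rotations" "s = r (0,1,1)" "t = r (-1,1,0) \<or> t = r (1,1,0)"
      using st(1) unfolding arcs by blast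
    then have r: "r \<in> set rotations" "t = r (-1,1,0) \<or> t = r (1,1,0)" "e = closed_segment (pt (r (0,1,1))) (pt t)"
      using st(2) by simp_all
    obtain g where g: "acts_as \<rho> g r" using all_words(2)[OF assms r(1)] by blast
    have gc: "g \<in> carrier (alt_group 4)" "g \<circ> c1 \<in> carrier (alt_group 4)" "g \<circ> c2 \<in> carrier (alt_group 4)"
      using g acts_as_comp[OF assms g c(1)] acts_as_comp[OF assms g c(2)] unfolding acts_as_def by auto
    obtain h where h: "h = g \<circ> c1 \<or> h = g \<circ> c2" "node \<rho> (1 / 2) (- 1 / 3) h = pt t"
      using r(2) n[OF g] by auto
    then have "h \<in> carrier (alt_group 4)" using gc by blast
    moreover have "e = closed_segment (node \<rho> (1 / 2) (- 1 / 3) g) (node \<rho> (1 / 2) (- 1 / 3) h)"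
      unfolding r(3) h(2) acts_node[OF g] by (rule refl)
    ultimately show "e \<in> cables \<rho> (1 / 2) (- 1 / 3)"
      unfolding cables_def alt_group_mult using gc(1) h(1) by blast
  qed
qed

section \<open>The cuboctahedron\<close>

text \<open>
  The plane \<open>n \<bullet> v = m\<close> supports the polytope and touches it exactly in the points of \<open>T\<close>.
\<close>

lemma convex_hull_face:
  fixes S :: "'a::euclidean_space set"
  assumes "finite S" "T \<subseteq> S" and on: "\<And>v. v \<in> T \<Longrightarrow> n \<bullet> v = m" and below: "\<And>v. v \<in> S - T \<Longrightarrow> n \<bullet> v < m"
  shows "convex hull T face_of convex hull S"
proof (rule face_of_convex_hulls[OF assms(1,2)])
  have "affine hull T \<subseteq> {v. n \<bullet> v = m}" using on by (intro hull_minimal affine_hyperplane) auto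
  moreover have "convex hull (S - T) \<subseteq> {v. n \<bullet> v < m}" using below by (intro hull_minimal convex_halfspace_lt) auto
  ultimately show "affine hull T \<inter> convex hull (S - T) = {}" by fastforce
qed

definition plus3 :: "triple \<Rightarrow> triple \<Rightarrow> triple" where
  "plus3 = (\<lambda>(a, b, c) (x, y, z). (a + x, b + y, c + z))"

lemma pt_plus3: "pt (plus3 s t) = pt s + pt t"
  by (cases s; cases t) (simp add: plus3_def pt_def vec3_def vec_eq_iff forall_3 distrib_left)

lemma pt_inner: "pt s \<bullet> pt t = 25 / 9 * of_int (dot s t)"
  by (cases s; cases t) (simp add: dot_def pt_def vec3_def inner_vec_def sum_3 algebra_simps)

lemma vertices_dot:
  "list_all (\<lambda>s. list_all (\<lambda>t. if s = t then dot s t = 2 else dot s t < 2) vertices) vertices"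
  by code_simp

text \<open>
  The value 3 is \<open>dot (s + t) s = dot (s + t) t\<close> for an edge.
\<close>

lemma vertices_edge:
  "list_all (\<lambda>s. list_all (\<lambda>t. dot s t = 1 \<longrightarrow>
     list_all (\<lambda>c. c = s \<or> c = t \<or> dot (plus3 s t) c < 3) vertices) vertices) vertices"
  by code_simp

text \<open>
  For inner product 0, \<open>c\<close> and \<open>d\<close> form the other diagonal of a square face; for \<open>-1\<close>, \<open>c = s + t\<close> is a vertex and \<open>d = 0\<close>; for
  \<open>-2\<close> the two points are opposite and any other diameter serves.
\<close>

lemma vertices_nonedge:
  "list_all (\<lambda>s. list_all (\<lambda>t. s = t \<or> dot s t = 1 \<or>
     list_ex (\<lambda>c. c \<noteq> s \<and> c \<noteq> t \<and> list_ex (\<lambda>d. c \<noteq> d \<and> plus3 c d = plus3 s t) ((0, 0, 0) # vertices)) vertices)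
     vertices) vertices"
  by code_simp

lemma arcs_vertices:
  "list_all (\<lambda>(s, t). s \<in> set vertices \<and> t \<in> set vertices \<and> dot s t = 1) arcs"
  by code_simp

lemma arcs_complete:
  "list_all (\<lambda>s. list_all (\<lambda>t. dot s t = 1 \<longrightarrow> (s, t) \<in> set arcs \<or> (t, s) \<in> set arcs) vertices) vertices"
  by code_simp

definition solid :: "(real ^ 3) set" where "solid = convex hull (pt ` set vertices)"

lemma solid_vertices: "{v. v extreme_point_of solid} = pt ` set vertices"
proof (intro equalityI subsetI)
  fix v assume "v \<in> {v. v extreme_point_of solid}"
  then show "v \<in> pt ` set vertices" unfolding solid_def using extreme_point_of_convex_hull by blast
next
  fix v assume "v \<in> pt ` set vertices"
  then obtain s where s: "s \<in> set vertices" "v = pt s" by blast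
  have d: "dot s s = 2" "\<And>t. t \<in> set vertices \<Longrightarrow> t \<noteq> s \<Longrightarrow> dot s t < 2"
    using vertices_dot s(1) by (auto simp: list_all_iff split: if_splits)
  have "convex hull {v} face_of solid"
    unfolding solid_def
  proof (rule convex_hull_face[where n = "pt s" and m = "25 / 9 * 2"])
    fix w assume "w \<in> pt ` set vertices - {v}"
    then obtain t where "t \<in> set vertices" "w = pt t" "t \<noteq> s" using s by auto
    then show "pt s \<bullet> w < 25 / 9 * 2" using d(2)[of t] by (simp add: pt_inner)
  qed (use s d in \<open>auto simp: pt_inner\<close>)
  then show "v \<in> {v. v extreme_point_of solid}" by (simp add: face_of_singleton)
qed

text \<open>
  A face that contains a midpoint of two points of the solid contains these points. Hence a segment is no edge
  if its midpoint is the midpoint of a second segment that starts in a vertex.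
\<close>

lemma solid_edges:
  "e edge_of solid \<longleftrightarrow> (\<exists>s t. s \<in> set vertices \<and> t \<in> set vertices \<and> dot s t = 1 \<and> e = closed_segment (pt s) (pt t))"
proof
  assume "e edge_of solid"
  then have e: "e face_of solid" "aff_dim e = 1" unfolding edge_of_def by auto
  have "compact solid" unfolding solid_def by (intro compact_convex_hull finite_imp_compact) simp
  then have "compact e" using face_of_imp_compact e(1) solid_def by (metis convex_convex_hull)
  moreover have "convex e" using e(1) by (rule face_of_imp_convex)
  moreover have "collinear e" using e(2) by (simp add: collinear_aff_dim)
  moreover have "e \<noteq> {}" using e(2) by auto
  ultimately obtain a b where ab: "e = closed_segment a b" using compact_convex_collinear_segment by blast
  have "a \<noteq> b" using e(2) unfolding ab by auto
  have ext: "x \<in> {a, b}" if "pt x' = x" "x' \<in> set vertices" "x \<in> e" for x x'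
  proof -
    have "x extreme_point_of solid" using that(1,2) solid_vertices by blast
    then have "x extreme_point_of e" using extreme_point_of_face[OF e(1)] that(3) by blast
    then show ?thesis unfolding ab extreme_point_of_segment by blast
  qed
  have "a extreme_point_of e" "b extreme_point_of e" unfolding ab extreme_point_of_segment by simp_all
  then have "a extreme_point_of solid" "b extreme_point_of solid" using extreme_point_of_face[OF e(1)] by blast+
  then obtain s t where st: "a = pt s" "b = pt t" "s \<in> set vertices" "t \<in> set vertices"
    using solid_vertices by blast
  have "dot s t = 1"
  proof (rule ccontr)
    assume "dot s t \<noteq> 1"
    then obtain c d where cd: "c \<in> set vertices" "c \<noteq> s" "c \<noteq> t" "d \<in> insert (0, 0, 0) (set vertices)" "c \<noteq> d"
        "plus3 c d = plus3 s t"
      using vertices_nonedge st \<open>a \<noteq> b\<close> unfolding list_all_iff list_ex_iff by (metis list.simps(15))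
    have "pt (0, 0, 0) \<in> solid"
    proof -
      have "midpoint (pt (0, 1, 1)) (pt (0, -1, -1)) \<in> solid"
      proof -
        have "closed_segment (pt (0, 1, 1)) (pt (0, -1, -1)) \<subseteq> solid"
          unfolding solid_def by (intro closed_segment_subset_convex_hull hull_inc imageI) (simp_all add: vertices_def)
        then show ?thesis using midpoint_in_closed_segment by blast
      qed
      moreover have "midpoint (pt (0, 1, 1)) (pt (0, -1, -1)) = pt (0, 0, 0)"
        unfolding midpoint_def pt_plus3[symmetric] by (simp add: plus3_def pt_def vec3_def vec_eq_iff forall_3)
      ultimately show ?thesis by simp
    qed
    then have mem: "pt c \<in> solid" "pt d \<in> solid" using cd unfolding solid_def by (auto intro: hull_inc)
    have "midpoint (pt c) (pt d) = midpoint a b"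
      unfolding midpoint_def st pt_plus3[symmetric] cd(6) ..
    moreover have "midpoint (pt c) (pt d) \<in> open_segment (pt c) (pt d)" using cd(5) by simp
    ultimately have "midpoint a b \<in> open_segment (pt c) (pt d)" by simp
    moreover have "midpoint a b \<in> e" unfolding ab by simp
    ultimately have "pt c \<in> e" using face_ofD[OF e(1)] mem by blast
    then show False using ext[OF refl cd(1)] cd st by auto
  qed
  then show "\<exists>s t. s \<in> set vertices \<and> t \<in> set vertices \<and> dot s t = 1 \<and> e = closed_segment (pt s) (pt t)"
    using st ab by blast
next
  assume "\<exists>s t. s \<in> set vertices \<and> t \<in> set vertices \<and> dot s t = 1 \<and> e = closed_segment (pt s) (pt t)"
  then obtain s t where st: "s \<in> set vertices" "t \<in> set vertices" "dot s t = 1" "e = closed_segment (pt s) (pt t)" by blast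
  have d: "dot s s = 2" "dot t t = 2" "dot t s = 1"
    using vertices_dot st by (auto simp: list_all_iff dot_def split_beta mult.commute split: if_splits)
  have c: "dot (plus3 s t) c < 3" if "c \<in> set vertices" "c \<noteq> s" "c \<noteq> t" for c
    using vertices_edge st that by (auto simp: list_all_iff)
  have "convex hull {pt s, pt t} face_of solid"
    unfolding solid_def
  proof (rule convex_hull_face[where n = "pt s + pt t" and m = "25 / 9 * 3"])
    fix w assume "w \<in> pt ` set vertices - {pt s, pt t}"
    then obtain c' where "c' \<in> set vertices" "w = pt c'" "c' \<noteq> s" "c' \<noteq> t" by auto
    then show "(pt s + pt t) \<bullet> w < 25 / 9 * 3" using c[of c'] by (simp add: pt_inner flip: pt_plus3)
  next
    fix w assume "w \<in> {pt s, pt t}"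
    then show "(pt s + pt t) \<bullet> w = 25 / 9 * 3" using st(3) d by (auto simp: inner_add_left pt_inner)
  qed (use st in auto)
  moreover have "s \<noteq> t" using st(3) d by auto
  ultimately show "e edge_of solid"
    unfolding edge_of_def st(4) segment_convex_hull by (simp add: aff_dim_convex_hull aff_dim_2)
qed

lemma std_cuboctahedron_hull: "std_cuboctahedron = convex hull (vec3 ` set vertices)"
proof -
  have ex_3: "(\<exists>i :: 3. P i) \<longleftrightarrow> P 1 \<or> P 2 \<or> P 3" for P by (metis exhaust_3)
  have "{v :: real ^ 3. \<exists>i. v $ i = 0 \<and> (\<forall>j. j \<noteq> i \<longrightarrow> \<bar>v $ j\<bar> = 1)} = vec3 ` set vertices" (is "?L = ?R")
  proof (intro equalityI subsetI)
    fix v assume "v \<in> ?R"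
    then show "v \<in> ?L" by (auto simp: vertices_def vec3_def forall_3 ex_3)
  next
    fix v assume "v \<in> ?L"
    then obtain i where i: "v $ i = 0" "\<forall>j. j \<noteq> i \<longrightarrow> \<bar>v $ j\<bar> = 1" by blast
    define a b c where abc: "a = v $ 1" "b = v $ 2" "c = v $ 3"
    have v: "v = vector [a, b, c]" by (simp add: abc vec_eq_iff forall_3)
    have "a = 0 \<and> \<bar>b\<bar> = 1 \<and> \<bar>c\<bar> = 1 \<or> b = 0 \<and> \<bar>a\<bar> = 1 \<and> \<bar>c\<bar> = 1 \<or> c = 0 \<and> \<bar>a\<bar> = 1 \<and> \<bar>b\<bar> = 1"
      using exhaust_3[of i] i unfolding abc by (elim disjE) simp_all
    moreover have "x = 1 \<or> x = -1" if "\<bar>x\<bar> = 1" for x :: real using that by linarith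
    ultimately have "a = 0 \<and> (b = 1 \<or> b = -1) \<and> (c = 1 \<or> c = -1) \<or> b = 0 \<and> (a = 1 \<or> a = -1) \<and> (c = 1 \<or> c = -1) \<or>
      c = 0 \<and> (a = 1 \<or> a = -1) \<and> (b = 1 \<or> b = -1)" by blast
    then show "v \<in> ?R" unfolding v
      by (elim disjE conjE) (simp_all add: vertices_def vec3_def)
  qed
  then show ?thesis unfolding std_cuboctahedron_def by simp
qed

lemma cuboctahedron_solid: "is_cuboctahedron solid"
proof -
  have "pt ` set vertices = (*\<^sub>R) (5 / 3) ` vec3 ` set vertices" by (simp add: pt_def image_image)
  then have "solid = (*\<^sub>R) (5 / 3) ` std_cuboctahedron"
    unfolding solid_def std_cuboctahedron_hull by (simp add: convex_hull_scaling)
  then have "solid = (\<lambda>v. 0 + (5 / 3) *\<^sub>R (\<lambda>v. v) v) ` std_cuboctahedron" by simp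
  moreover have "orthogonal_transformation (\<lambda>v :: real ^ 3. v)" by (simp add: orthogonal_transformation_def linear_iff)
  ultimately show ?thesis unfolding is_cuboctahedron_def
    by (intro exI[of _ "5 / 3"] exI[of _ "0 :: real ^ 3"] exI[of _ "\<lambda>v :: real ^ 3. v"] conjI) simp_all
qed

lemma cables_edges:
  assumes "is_rho \<rho>" shows "cables \<rho> (1 / 2) (- 1 / 3) = {e. e edge_of solid}"
  unfolding cables_half[OF assms]
proof (intro equalityI subsetI)
  fix e assume "e \<in> {closed_segment (pt s) (pt t) | s t. (s, t) \<in> set arcs}"
  then obtain s t where "(s, t) \<in> set arcs" "e = closed_segment (pt s) (pt t)" by blast
  moreover from this have "s \<in> set vertices \<and> t \<in> set vertices \<and> dot s t = 1"
    using arcs_vertices by (auto simp: list_all_iff)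
  ultimately show "e \<in> {e. e edge_of solid}" unfolding solid_edges by blast
next
  fix e assume "e \<in> {e. e edge_of solid}"
  then obtain s t where st: "s \<in> set vertices" "t \<in> set vertices" "dot s t = 1" "e = closed_segment (pt s) (pt t)"
    unfolding solid_edges by blast
  then have "(s, t) \<in> set arcs \<or> (t, s) \<in> set arcs" using arcs_complete by (auto simp: list_all_iff)
  then show "e \<in> {closed_segment (pt s) (pt t) | s t. (s, t) \<in> set arcs}"
    using st(4) closed_segment_commute by blast
qed

text \<open>
  The vector \<open>(0, 1, 1)\<close> is in the kernel. The inverses in the stress matrix are squares, since \<open>c1\<close>, \<open>c2\<close> and \<open>g1\<close>
  have order 3.
\<close>

lemma det_stress_half:
  assumes "is_rho \<rho>" shows "det (stress \<rho> (1 / 2) (- 1 / 3)) = 0"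
proof -
  interpret group "alt_group 4" by (rule alt_group_is_group)
  have inv: "inv\<^bsub>alt_group 4\<^esub> g = g \<circ> g" if "g \<in> carrier (alt_group 4)" "g \<circ> g \<circ> g = id" for g
    using that inv_equality[of "g \<circ> g" g] m_closed[of g g] by (simp add: alt_group_mult alt_group_one)
  have c: "acts_as \<rho> c1 (turn1 \<circ> turn2)" "acts_as \<rho> c2 (turn1 \<circ> turn3)"
    unfolding generators_eq(4,5) by (intro acts_as_comp generators_act assms)+
  have sym: "real_mat (\<rho> g + \<rho> (inv\<^bsub>alt_group 4\<^esub> g)) *v pt t = pt (r t) + pt (r (r t))"
    if "acts_as \<rho> g r" "g \<circ> g \<circ> g = id" for g r t
  proof -
    have "g \<in> carrier (alt_group 4)" using that(1) unfolding acts_as_def by blast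
    then show ?thesis
      using acts_pt[OF that(1)] acts_pt[OF acts_as_comp[OF assms that(1) that(1)]] that(2)
      by (simp add: inv real_mat_add matrix_vector_mult_add_rdistrib)
  qed
  have "c1 \<circ> c1 \<circ> c1 = id" "c2 \<circ> c2 \<circ> c2 = id" "g1 \<circ> g1 \<circ> g1 = id"
    unfolding c1_def c2_def g1_def by (auto simp: fun_eq_iff Transposition.transpose_def)
  note s = sym[OF c(1) this(1)] sym[OF c(2) this(2)] sym[OF generators_act(1)[OF assms] this(3)]
  let ?A = "stress \<rho> (1 / 2) (- 1 / 3)"
  have "?A *v pt (0, 1, 1) = 0"
    unfolding stress_def Let_def
    by (simp add: s matrix_vector_mult_add_rdistrib matrix_vector_mult_diff_rdistrib flip: scaleR_matrix_vector_assoc)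
       (simp add: turn1_def turn2_def turn3_def pt_def vec3_def vec_eq_iff forall_3)
  moreover have "pt (0, 1, 1) \<noteq> 0" by (simp add: pt_def vec3_def vec_eq_iff forall_3)
  ultimately have "\<not> invertible ?A"
    unfolding invertible_left_inverse matrix_left_invertible_ker by blast
  then show ?thesis by (simp add: invertible_det_nz)
qed

section \<open>The classification\<close>

lemma stable_rational_points:
  assumes "is_rho \<rho>"
  shows "{P \<in> (proj_closure cubic_C :: (rat \<times> rat \<times> rat) set set).
    \<exists>x y. P = aff_pt (x, y) \<and> (of_rat x, of_rat y) \<in> stable_params \<rho>} = {aff_pt (1/2, -1/3)}"
proof (intro equalityI subsetI)
  fix P :: "(rat \<times> rat \<times> rat) set"
  assume "P \<in> {P \<in> proj_closure cubic_C. \<exists>x y. P = aff_pt (x, y) \<and> (of_rat x, of_rat y) \<in> stable_params \<rho>}"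
  then obtain x y where P: "P \<in> proj_closure cubic_C" "P = aff_pt (x, y)" "(of_rat x, of_rat y) \<in> stable_params \<rho>"
    by blast
  have "0 < (of_rat x :: real)" "(of_rat x :: real) < 1" "of_rat (-1/3) \<le> (of_rat y :: real)"
    using P(3) by (simp_all add: stable_params_def of_rat_divide of_rat_minus)
  then have r: "0 < x" "x < 1" "-1/3 \<le> y"
    by (simp_all only: zero_less_of_rat_iff of_rat_less_1_iff of_rat_less_eq)
  have "(x, y) \<in> {(1, 0), (3, 3), (1/2, -1/3), (0, 0), (-2, 3), (3, -2), (1, -1), (1/2, -3/4), (-2, -2), (0, -1)}"
    using P(1) unfolding P(2) aff_pt_closure_iff rational_affine_points .
  then have "(x, y) = (1/2, -1/3)"
    unfolding insert_iff empty_iff prod.inject using r by (elim disjE conjE FalseE) simp_all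
  then show "P \<in> {aff_pt (1/2, -1/3)}" unfolding P(2) by (simp only: singleton_iff)
next
  fix P :: "(rat \<times> rat \<times> rat) set"
  assume "P \<in> {aff_pt (1/2, -1/3)}"
  moreover have "aff_pt (1/2 :: rat, -1/3) \<in> proj_closure cubic_C"
    unfolding aff_pt_closure_iff rational_affine_points by simp
  moreover have "(of_rat (1/2), of_rat (-1/3)) \<in> stable_params \<rho>"
    using det_stress_half[OF assms] by (simp add: stable_params_def of_rat_divide of_rat_minus)
  ultimately show "P \<in> {P \<in> proj_closure cubic_C. \<exists>x y. P = aff_pt (x, y) \<and> (of_rat x, of_rat y) \<in> stable_params \<rho>}"
    by blast
qed

theorem mainTheorem2:
  fixes \<rho> :: "(nat \<Rightarrow> nat) \<Rightarrow> int ^ 3 ^ 3"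
  assumes "is_rho \<rho>"
  shows
    "nonsingular cubic_C \<and>
     nonsingular curve_E0 \<and>
     weierstrass_iso curve_E0 cremona_30a2 \<and>
     birational_via map_UV cubic_C curve_E0 \<and>
     (proj_closure cubic_C :: (rat \<times> rat \<times> rat) set set) =
       aff_pt ` {(1, 0), (3, 3), (1/2, -1/3), (0, 0), (-2, 3),
                 (3, -2), (1, -1), (1/2, -3/4), (-2, -2), (0, -1)}
       \<union> {proj_pt 0 1 0, proj_pt 1 0 0} \<and>
     card (proj_closure cubic_C :: (rat \<times> rat \<times> rat) set set) = 12 \<and>
     {P \<in> (proj_closure cubic_C :: (rat \<times> rat \<times> rat) set set).
        \<exists>x y. P = aff_pt (x, y) \<and> (of_rat x, of_rat y) \<in> stable_params \<rho>}
       = {aff_pt (1/2, -1/3)} \<and>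
     (\<exists>P. is_cuboctahedron P \<and>
        nodes \<rho> (1/2) (-1/3) = {v. v extreme_point_of P} \<and>
        cables \<rho> (1/2) (-1/3) = {e. e edge_of P})"
proof (intro conjI)
  show "\<exists>P. is_cuboctahedron P \<and> nodes \<rho> (1/2) (-1/3) = {v. v extreme_point_of P} \<and>
      cables \<rho> (1/2) (-1/3) = {e. e edge_of P}"
    using cuboctahedron_solid nodes_half[OF assms] solid_vertices cables_edges[OF assms]
    by (intro exI[of _ solid]) simp
qed (fact nonsingular_cubic_C nonsingular_curve_E0 weierstrass_iso_E0 birational_map_UV
    rational_points_cubic_C card_rational_points_cubic_C stable_rational_points[OF assms])+

end
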